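(* Let $d\in\mathbb{N}$ and $\eta>1/d$. Then \[\dim_H(\mathcal{D}(\eta))=\frac{d+1}{1+\eta}.\]
   Context: For $\boldsymbol{\alpha}\in\mathbb{R}^d$ and $\eta\in\mathbb{R}$, let $\mathrm{NA}_\eta(\boldsymbol{\alpha})=\{|q|^{\eta}(q\boldsymbol{\alpha}-\boldsymbol{p}):q\in\mathbb{Z}\setminus\{0\},\ \boldsymbol{p}\in\mathbb{Z}^d\}$ and let $\mathcal{A}_\eta(\boldsymbol{\alpha})$ be the set of accumulation points of $\mathrm{NA}_\eta(\boldsymbol{\alpha})$. Define $\mathcal{D}(\eta)=\{\boldsymbol{\alpha}\in\mathbb{R}^d:\mathcal{A}_\eta(\boldsymbol{\alpha})=\mathbb{R}^d\}$. $\dim_H$ denotes Hausdorff dimension. *)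

theory Defs
  imports "HOL-Analysis.Analysis"
begin

definition hd_gauge :: "'a::metric_space set \<Rightarrow> real \<Rightarrow> real" where
  "hd_gauge U s = (if U = {} then 0 else if s = 0 then 1 else diameter U powr s)"

definition hausdorff_content :: "real \<Rightarrow> real \<Rightarrow> 'a::metric_space set \<Rightarrow> ennreal" where
  "hausdorff_content s \<delta> E =
     (INF U \<in> {U :: nat \<Rightarrow> 'a set. E \<subseteq> (\<Union>i. U i) \<and> (\<forall>i. bounded (U i) \<and> diameter (U i) \<le> \<delta>)}.
        (\<Sum>i. ennreal (hd_gauge (U i) s)))"

definition hausdorff_measure :: "real \<Rightarrow> 'a::metric_space set \<Rightarrow> ennreal" where
  "hausdorff_measure s E = (SUP \<delta> \<in> {0<..}. hausdorff_content s \<delta> E)"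

definition hausdorff_dim :: "'a::metric_space set \<Rightarrow> real" where
  "hausdorff_dim E = Inf {s. s \<ge> 0 \<and> hausdorff_measure s E = 0}"

definition int_vecs :: "(real ^ 'd) set" where
  "int_vecs = {p. \<forall>i. p $ i \<in> \<int>}"

definition NA :: "real \<Rightarrow> real ^ 'd \<Rightarrow> (real ^ 'd) set" where
  "NA \<eta> \<alpha> = {(\<bar>real_of_int q\<bar> powr \<eta>) *\<^sub>R (real_of_int q *\<^sub>R \<alpha> - p) | q p.
                 q \<noteq> 0 \<and> p \<in> int_vecs}"

definition acc_NA :: "real \<Rightarrow> real ^ 'd \<Rightarrow> (real ^ 'd) set" where
  "acc_NA \<eta> \<alpha> = {x. x islimpt NA \<eta> \<alpha>}"

definition D_set :: "real \<Rightarrow> (real ^ 'd) set" where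
  "D_set \<eta> = {\<alpha>. acc_NA \<eta> \<alpha> = UNIV}"

end

theory Submission
  imports Defs
begin

text \<open>
  Upper bound: if 0 is an accumulation point of the scaled errors, then \<open>\<alpha>\<close> lies within
  \<open>q powr (-1-\<eta>)\<close> of \<open>p/q\<close> for infinitely many \<open>q\<close>, and the natural cover by boxes around
  rational points is summable for every exponent above \<open>(d+1)/(1+\<eta>)\<close>.

  Lower bound: let \<open>s < (d+1)/(1+\<eta>)\<close> and let sets \<open>U i\<close> of diameter at most \<open>u i\<close> have small
  total \<open>\<Sum> (u i) powr s\<close>. A point of the set avoiding every \<open>U i\<close> is the intersection of nested
  boxes; each step forces some scaled error of all points of the new box to be close to a prescribed
  target. By Dirichlet's theorem, inside a box of side \<open>r\<close> a positive proportion of the points of a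
  grid with mesh of order \<open>N powr (-d-1)\<close> is within a quarter mesh of some \<open>p/q\<close> with \<open>q\<close> of order
  \<open>N^d\<close>, because small denominators serve few grid points. Each of these gives a candidate sub-box
  of radius of order \<open>N powr (-d(1+\<eta>))\<close>. A set \<open>U i\<close> below the mesh size meets at most one
  candidate, a larger one meets at most \<open>O((u i / mesh)^d)\<close> of them. Averaging over the candidates
  shows that the potential \<open>\<Sum> min 1 (C (u i / r) powr s)\<close>, taken over the \<open>U i\<close> meeting the
  current box, can be kept below 1. This replaces the usual measure on a Cantor set.
\<close>

section \<open>Counting lattice points\<close>

lemma int_near_eq_interval:
  "{k::int. \<bar>real_of_int k - a\<bar> \<le> r} = {\<lceil>a - r\<rceil>..\<lfloor>a + r\<rfloor>}"
  by (auto simp: abs_le_iff ceiling_le_iff le_floor_iff)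

lemma card_int_near_le:
  assumes "r \<ge> 0"
  shows "real (card {k::int. \<bar>real_of_int k - a\<bar> \<le> r}) \<le> 2 * r + 1"
  unfolding int_near_eq_interval using assms by simp linarith

lemma card_int_near_ge: "2 * r - 1 \<le> real (card {k::int. \<bar>real_of_int k - a\<bar> \<le> r})"
  unfolding int_near_eq_interval by simp linarith

lemma lattice_near_eq_Pi:
  "{z::'d::finite \<Rightarrow> int. \<forall>i. \<bar>real_of_int (z i) - a i\<bar> \<le> r}
     = (\<Pi>\<^sub>E i\<in>UNIV. {k. \<bar>real_of_int k - a i\<bar> \<le> r})"
  by (auto simp: PiE_UNIV_domain)

lemma finite_lattice_near:
  "finite {z::'d::finite \<Rightarrow> int. \<forall>i. \<bar>real_of_int (z i) - a i\<bar> \<le> r}"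
  unfolding lattice_near_eq_Pi by (intro finite_PiE) (auto simp: int_near_eq_interval)

lemma card_lattice_near_le:
  assumes "r \<ge> 0"
  shows "real (card {z::'d::finite \<Rightarrow> int. \<forall>i. \<bar>real_of_int (z i) - a i\<bar> \<le> r}) \<le> (2 * r + 1) ^ CARD('d)"
proof -
  have "(\<Prod>i\<in>(UNIV::'d set). real (card {k::int. \<bar>real_of_int k - a i\<bar> \<le> r})) \<le> (\<Prod>i\<in>(UNIV::'d set). 2 * r + 1)"
    by (intro prod_mono conjI card_int_near_le assms) auto
  then show ?thesis
    unfolding lattice_near_eq_Pi by (simp add: card_PiE)
qed

lemma card_lattice_near_ge:
  assumes "r \<ge> 1"
  shows "r ^ CARD('d) \<le> real (card {z::'d::finite \<Rightarrow> int. \<forall>i. \<bar>real_of_int (z i) - a i\<bar> \<le> r})"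
proof -
  have "r \<le> real (card {k::int. \<bar>real_of_int k - a i\<bar> \<le> r})" for i
    using card_int_near_ge[of r "a i"] assms by linarith
  then have "(\<Prod>i\<in>(UNIV::'d set). r) \<le> (\<Prod>i\<in>(UNIV::'d set). real (card {k::int. \<bar>real_of_int k - a i\<bar> \<le> r}))"
    using assms by (intro prod_mono) auto
  then show ?thesis
    unfolding lattice_near_eq_Pi by (simp add: card_PiE)
qed

section \<open>Grid points near rationals with large denominator\<close>

text \<open>Transfers simultaneous Dirichlet approximation from indices below
  \<open>CARD('d)\<close> to the type \<open>'d\<close> along a bijection, and makes the denominator
  a natural number.\<close>

lemma Dirichlet_approx_finite_type:
  fixes \<theta> :: "'d::finite \<Rightarrow> real"
  assumes "N > 0"
  obtains q :: nat and p :: "'d \<Rightarrow> int"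
  where "0 < q" "q \<le> N ^ CARD('d)" "\<And>i. \<bar>real q * \<theta> i - real_of_int (p i)\<bar> < 1 / real N"
proof -
  obtain e where e: "bij_betw e {0..<CARD('d)} (UNIV :: 'd set)"
    using ex_bij_betw_nat_finite[OF finite_class.finite_UNIV] by blast
  define f where "f = the_inv_into {0..<CARD('d)} e"
  have f: "f i < CARD('d)" "e (f i) = i" for i
    using e f_the_inv_into_f_bij_betw[OF e] the_inv_into_into[of e "{0..<CARD('d)}" i "{0..<CARD('d)}"]
    by (auto simp: f_def bij_betw_def)
  obtain q p where qp: "0 < q" "q \<le> int (N ^ CARD('d))"
      "\<And>j. j < CARD('d) \<Longrightarrow> \<bar>of_int q * \<theta> (e j) - of_int (p j)\<bar> < 1 / N"
    using Dirichlet_approx_simult[OF assms, of "CARD('d)" "\<lambda>j. \<theta> (e j)"] by blast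
  show thesis
  proof
    show "0 < nat q" "nat q \<le> N ^ CARD('d)"
      using qp(1,2) by (simp, linarith)
    show "\<bar>real (nat q) * \<theta> i - real_of_int (p (f i))\<bar> < 1 / real N" for i
      using qp(3)[OF f(1)[of i]] qp(1) f(2)[of i] by simp
  qed
qed

lemma card_UN_le_sum_bound:
  assumes "finite I" "\<And>i. i \<in> I \<Longrightarrow> real (card (A i)) \<le> b i"
  shows "real (card (\<Union>i\<in>I. A i)) \<le> (\<Sum>i\<in>I. b i)"
proof -
  have "real (card (\<Union>i\<in>I. A i)) \<le> (\<Sum>i\<in>I. real (card (A i)))"
    using card_UN_le[OF assms(1), of A] by (metis of_nat_le_iff of_nat_sum)
  also have "\<dots> \<le> (\<Sum>i\<in>I. b i)"
    using assms(2) by (rule sum_mono)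
  finally show ?thesis .
qed

text \<open>
  The ratio is chosen so that at most half of the grid points of a box have a Dirichlet denominator
  below \<open>grid_ratio d * N ^ d\<close>; above that bound the Dirichlet error \<open>1 / (N * q)\<close> is at most a
  quarter of the mesh.
\<close>

definition grid_ratio :: "nat \<Rightarrow> real" where
  "grid_ratio d = 1 / (4 * 16 ^ d)"

definition grid_mesh :: "nat \<Rightarrow> nat \<Rightarrow> real" where
  "grid_mesh d N = 4 / (grid_ratio d * real N ^ (d + 1))"

lemma grid_ratio_pos [simp]: "grid_ratio d > 0"
  by (simp add: grid_ratio_def)

lemma grid_mesh_pos: "N > 0 \<Longrightarrow> grid_mesh d N > 0"
  by (simp add: grid_mesh_def)

text \<open>Split at \<open>q = 9 / (2 * r)\<close>. From there on \<open>9 / (2 * q)\<close> is at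
  most \<open>r\<close>, so each term is at most \<open>(4 * r) ^ d\<close>. The few smaller
  denominators together give a bound independent of \<open>X\<close>, negligible once
  \<open>X\<close> is large.\<close>

lemma small_denominators_sum_le:
  fixes r X :: real
  assumes "r > 0" "X \<ge> 0"
  shows "(\<Sum>q\<in>{q::nat. 0 < q \<and> real q < X}. (3 * r + 9 / (2 * real q)) ^ d)
           \<le> X * (4 * r) ^ d + (9 / (2 * r) + 1) * (3 * r + 9/2) ^ d"
proof -
  define I where "I = {q::nat. 0 < q \<and> real q < X}"
  define J where "J = {q::nat. real q < 9 / (2 * r)}"
  have Isub: "I \<subseteq> {0<..nat \<lfloor>X\<rfloor>}"
    unfolding I_def by (auto simp: le_nat_iff le_floor_iff)
  then have fI: "finite I"
    using finite_subset by blast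
  have cI: "real (card I) \<le> X"
  proof -
    have "card I \<le> nat \<lfloor>X\<rfloor>"
      using card_mono[OF _ Isub] by simp
    then show ?thesis using assms(2) by linarith
  qed
  have Jsub: "J \<subseteq> {..nat \<lfloor>9 / (2 * r)\<rfloor>}"
    unfolding J_def using assms by (auto simp: nat_le_real_less) linarith
  then have fJ: "finite J"
    using finite_subset by blast
  have cJ: "real (card J) \<le> 9 / (2 * r) + 1"
  proof -
    have "card J \<le> nat \<lfloor>9 / (2 * r)\<rfloor> + 1"
      using card_mono[OF _ Jsub] by simp
    moreover have "9 / (2 * r) \<ge> 0" using assms by simp
    ultimately show ?thesis by linarith
  qed
  have pw: "(3 * r + 9 / (2 * real q)) ^ d \<le> (4 * r) ^ d + (if q \<in> J then (3 * r + 9/2) ^ d else 0)"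
    if "q \<in> I" for q
  proof (cases "q \<in> J")
    case True
    have "9 / (2 * real q) \<le> 9 / 2"
      using that by (auto simp: I_def field_simps)
    then have "(3 * r + 9 / (2 * real q)) ^ d \<le> (3 * r + 9/2) ^ d"
      using assms by (intro power_mono) auto
    moreover have "(4 * r) ^ d \<ge> 0" using assms by simp
    ultimately show ?thesis using True by simp
  next
    case False
    then have "9 / (2 * real q) \<le> r"
      using that assms by (auto simp: I_def J_def field_simps)
    then have "(3 * r + 9 / (2 * real q)) ^ d \<le> (4 * r) ^ d"
      using assms by (intro power_mono) auto
    then show ?thesis using False by simp
  qed
  have "(\<Sum>q\<in>I. (3 * r + 9 / (2 * real q)) ^ d)
      \<le> (\<Sum>q\<in>I. (4 * r) ^ d + (if q \<in> J then (3 * r + 9/2) ^ d else 0))"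
    by (intro sum_mono pw)
  also have "\<dots> = card I * (4 * r) ^ d + card (I \<inter> J) * (3 * r + 9/2) ^ d"
    using fI by (simp add: sum.distrib sum.If_cases Int_def)
  also have "\<dots> \<le> X * (4 * r) ^ d + (9 / (2 * r) + 1) * (3 * r + 9/2) ^ d"
  proof (intro add_mono mult_right_mono)
    have "card (I \<inter> J) \<le> card J"
      by (intro card_mono fJ) auto
    then show "real (card (I \<inter> J)) \<le> 9 / (2 * r) + 1"
      using cJ by linarith
  qed (use cI assms in auto)
  finally show ?thesis unfolding I_def .
qed

text \<open>Union bound over the bad grid points, those without an approximation of denominator at
  least \<open>X = \<kappa> * N ^ D\<close>. The number of numerators per \<open>q\<close>, times
  the number of grid points near one \<open>p / q\<close>, summed over \<open>q < X\<close>, is at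
  most half of the lower bound for all grid points in the box.\<close>

lemma eventually_many_good_grid_points:
  fixes c :: "'d::finite \<Rightarrow> real" and r :: real
  assumes r: "r > 0"
  defines "D \<equiv> CARD('d)"
  shows "\<forall>\<^sub>F N::nat in sequentially. \<exists>Z :: ('d \<Rightarrow> int) set. finite Z \<and>
      (r / grid_mesh D N) ^ D / 2 \<le> real (card Z) \<and>
      (\<forall>z\<in>Z. (\<forall>i. \<bar>grid_mesh D N * real_of_int (z i) - c i\<bar> \<le> r) \<and>
         (\<exists>(q::nat) (p::'d \<Rightarrow> int). grid_ratio D * real N ^ D \<le> real q \<and> q \<le> N ^ D \<and>
            (\<forall>i. \<bar>grid_mesh D N * real_of_int (z i) - real_of_int (p i) / real q\<bar> \<le> grid_mesh D N / 4)))"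
proof -
  define K where "K = (9 / (2 * r) + 1) * (3 * r + 9/2) ^ D"
  have Dpos: "D > 0" by (simp add: D_def)
  have ev1: "\<forall>\<^sub>F N::nat in sequentially. N > 0"
    by (rule eventually_gt_at_top)
  \<comment> \<open>The first bound on \<open>N\<close> lets the remainder \<open>K\<close> fit into
    half of the allowance for bad points. The second gives \<open>r / h \<ge> 1\<close>, as the
    lower lattice count requires.\<close>
  have ev2: "\<forall>\<^sub>F N::nat in sequentially. real N \<ge> max (K * (4 * 4 ^ D) / r ^ D) (4 / (grid_ratio D * r))"
    using filterlim_real_sequentially unfolding filterlim_at_top by blast
  show ?thesis
    using ev1 ev2
  proof eventually_elim
    case (elim N)
    define \<kappa> where "\<kappa> = grid_ratio D"
    define h where "h = grid_mesh D N"
    define Q where "Q = real N ^ D"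
    define X where "X = \<kappa> * Q"
    have N: "real N \<ge> 1" using elim by simp
    have \<kappa>: "\<kappa> > 0" by (simp add: \<kappa>_def)
    have h: "h > 0" using grid_mesh_pos elim by (simp add: h_def)
    have Q: "Q > 0" "Q \<ge> real N"
      using elim(1) N power_increasing[of 1 D "real N"] Dpos by (auto simp: Q_def)
    have X: "X > 0" using \<kappa> Q by (simp add: X_def)
    have hX: "h = 4 / (X * real N)"
      by (simp add: h_def grid_mesh_def X_def Q_def \<kappa>_def mult_ac)
    define G where "G = {z::'d \<Rightarrow> int. \<forall>i. \<bar>real_of_int (z i) - c i / h\<bar> \<le> r / h}"
    define good where "good z \<longleftrightarrow> (\<exists>(q::nat) (p::'d \<Rightarrow> int). X \<le> real q \<and> q \<le> N ^ D \<and>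
            (\<forall>i. \<bar>h * real_of_int (z i) - real_of_int (p i) / real q\<bar> \<le> h / 4))" for z :: "'d \<Rightarrow> int"
    have scale: "\<bar>h * real_of_int k - a\<bar> = h * \<bar>real_of_int k - a / h\<bar>" for k a
    proof -
      have "h * real_of_int k - a = h * (real_of_int k - a / h)" using h by (simp add: field_simps)
      then show ?thesis using h by (simp add: abs_mult)
    qed
    have fG: "finite G"
      unfolding G_def by (rule finite_lattice_near)
    have Gc: "\<bar>h * real_of_int (z i) - c i\<bar> \<le> r" if "z \<in> G" for z i
      using that h unfolding scale by (auto simp: G_def field_simps)
    have rh: "r / h \<ge> 1"
    proof -
      have "4 / (grid_ratio D * r) \<le> real N" using elim(2) by simp
      then have "4 \<le> real N * (\<kappa> * r)" using r \<kappa> by (simp add: \<kappa>_def field_simps)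
      also have "\<dots> \<le> Q * real N * (\<kappa> * r)"
        using N Q r \<kappa> by (intro mult_right_mono) (auto simp: mult_le_cancel_right1)
      finally show ?thesis
        using X N by (simp add: hX X_def mult_ac)
    qed
    have cG: "(r / h) ^ D \<le> real (card G)"
      unfolding G_def D_def by (rule card_lattice_near_ge[OF rh])
    define I where "I = {q::nat. 0 < q \<and> real q < X}"
    define P where "P q = {p::'d \<Rightarrow> int. \<forall>i. \<bar>real_of_int (p i) - real q * c i\<bar> \<le> real q * r + 1}" for q :: nat
    define A where "A q p = {z::'d \<Rightarrow> int. \<forall>i. \<bar>real_of_int (z i) - real_of_int (p i) / real q / h\<bar> \<le> 1 / (real N * real q * h)}"
      for q :: nat and p :: "'d \<Rightarrow> int"
    have fI: "finite I"
    proof (rule finite_subset)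
      show "I \<subseteq> {..nat \<lfloor>X\<rfloor>}"
        unfolding I_def by (auto simp: le_nat_iff le_floor_iff)
    qed simp
    \<comment> \<open>A bad point still has a Dirichlet approximation, whose denominator must then
      be below \<open>X\<close>. \<open>P q\<close> contains all numerators that can occur for
      points of the box, and \<open>A q p\<close> the grid points within the Dirichlet error of
      \<open>p / q\<close>.\<close>
    have bad: "{z \<in> G. \<not> good z} \<subseteq> (\<Union>q\<in>I. \<Union>p\<in>P q. A q p)"
    proof
      fix z assume "z \<in> {z \<in> G. \<not> good z}"
      then have z: "z \<in> G" "\<not> good z" by auto
      obtain q p where qp: "0 < q" "q \<le> N ^ D"
        "\<And>i. \<bar>real q * (h * real_of_int (z i)) - real_of_int (p i)\<bar> < 1 / real N"
        using Dirichlet_approx_finite_type[OF elim(1), where \<theta>="\<lambda>i::'d. h * real_of_int (z i)"]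
        unfolding D_def by metis
      have near: "\<bar>h * real_of_int (z i) - real_of_int (p i) / real q\<bar> \<le> 1 / (real N * real q)" for i
      proof -
        have "h * real_of_int (z i) - real_of_int (p i) / real q
            = (real q * (h * real_of_int (z i)) - real_of_int (p i)) / real q"
          using qp(1) by (simp add: field_simps)
        then have "\<bar>h * real_of_int (z i) - real_of_int (p i) / real q\<bar>
            = \<bar>real q * (h * real_of_int (z i)) - real_of_int (p i)\<bar> / real q" by simp
        also have "\<dots> \<le> (1 / real N) / real q"
          using qp(3)[of i] by (intro divide_right_mono) auto
        finally show ?thesis by simp
      qed
      have "real q < X"
      proof (rule ccontr)
        assume "\<not> real q < X"
        then have "1 / (real N * real q) \<le> 1 / (real N * X)"
          using N X by (intro divide_left_mono mult_left_mono mult_pos_pos) auto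
        also have "\<dots> = h / 4" by (simp add: hX mult_ac)
        finally have "\<bar>h * real_of_int (z i) - real_of_int (p i) / real q\<bar> \<le> h / 4" for i
          using near[of i] by linarith
        then have "good z"
          unfolding good_def using \<open>\<not> real q < X\<close> qp(2)
          by (intro exI[of _ q] exI[of _ p]) auto
        then show False using z by simp
      qed
      then have "q \<in> I" using qp by (simp add: I_def)
      moreover have "p \<in> P q"
        unfolding P_def
      proof safe
        fix i
        have "1 / real N \<le> 1" using N by simp
        then have "\<bar>real q * (h * real_of_int (z i)) - real_of_int (p i)\<bar> \<le> 1"
          using qp(3)[of i] by linarith
        moreover have "\<bar>real q * (h * real_of_int (z i)) - real q * c i\<bar> \<le> real q * r"
          using Gc[OF z(1), of i] by (simp add: abs_mult mult_left_mono flip: right_diff_distrib)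
        ultimately show "\<bar>real_of_int (p i) - real q * c i\<bar> \<le> real q * r + 1" by linarith
      qed
      moreover have "z \<in> A q p"
        unfolding A_def
      proof safe
        fix i
        show "\<bar>real_of_int (z i) - real_of_int (p i) / real q / h\<bar> \<le> 1 / (real N * real q * h)"
          using near[of i] h unfolding scale
          by (subst divide_divide_eq_left[symmetric, of 1 _ h], subst pos_le_divide_eq) (simp_all add: mult.commute)
      qed
      ultimately show "z \<in> (\<Union>q\<in>I. \<Union>p\<in>P q. A q p)" by blast
    qed
    have fP: "finite (P q)" for q unfolding P_def by (rule finite_lattice_near)
    have fA: "finite (A q p)" for q p unfolding A_def by (rule finite_lattice_near)
    have cq: "real (card (\<Union>p\<in>P q. A q p)) \<le> X ^ D * (3 * r + 9 / (2 * real q)) ^ D" if "q \<in> I" for q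
    proof -
      have q: "q > 0" "real q < X" using that by (auto simp: I_def)
      \<comment> \<open>With \<open>h = 4 / (X * N)\<close> the radius in grid units is
        \<open>X / (4 * q)\<close>. The additive 1 of the lattice count is absorbed because
        \<open>q < X\<close>.\<close>
      have "2 * (1 / (real N * real q * h)) + 1 = X / (2 * real q) + 1"
        using N X q by (simp add: hX)
      also have "\<dots> \<le> X / (2 * real q) + X / real q"
        using q by (intro add_left_mono) (simp add: field_simps)
      also have "\<dots> = X * (3 / (2 * real q))"
        using q by (simp add: field_simps)
      finally have b: "2 * (1 / (real N * real q * h)) + 1 \<le> X * (3 / (2 * real q))" .
      have "real (card (A q p)) \<le> (2 * (1 / (real N * real q * h)) + 1) ^ D" for p
        unfolding A_def D_def using h by (intro card_lattice_near_le) auto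
      moreover have "(2 * (1 / (real N * real q * h)) + 1) ^ D \<le> (X * (3 / (2 * real q))) ^ D"
        using b h by (intro power_mono) auto
      ultimately have "real (card (A q p)) \<le> (X * (3 / (2 * real q))) ^ D" for p
        by (meson order_trans)
      then have "real (card (\<Union>p\<in>P q. A q p)) \<le> (\<Sum>p\<in>P q. (X * (3 / (2 * real q))) ^ D)"
        by (intro card_UN_le_sum_bound fP) auto
      also have "\<dots> = card (P q) * (X * (3 / (2 * real q))) ^ D" by simp
      also have "\<dots> \<le> (2 * (real q * r + 1) + 1) ^ D * (X * (3 / (2 * real q))) ^ D"
        unfolding P_def D_def using r X by (intro mult_right_mono card_lattice_near_le) auto
      also have "\<dots> = X ^ D * (3 * r + 9 / (2 * real q)) ^ D"
      proof -
        have "(2 * (real q * r + 1) + 1) * (X * (3 / (2 * real q))) = X * (3 * r + 9 / (2 * real q))"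
          using q by (simp add: field_simps)
        then show ?thesis by (metis power_mult_distrib)
      qed
      finally show ?thesis .
    qed
    have "real (card {z \<in> G. \<not> good z}) \<le> real (card (\<Union>q\<in>I. \<Union>p\<in>P q. A q p))"
      using bad fI fP fA by (intro of_nat_mono card_mono) auto
    also have "\<dots> \<le> (\<Sum>q\<in>I. X ^ D * (3 * r + 9 / (2 * real q)) ^ D)"
      by (intro card_UN_le_sum_bound fI cq)
    also have "\<dots> = X ^ D * (\<Sum>q\<in>I. (3 * r + 9 / (2 * real q)) ^ D)"
      by (simp add: sum_distrib_left)
    also have "\<dots> \<le> X ^ D * (X * (4 * r) ^ D + K)"
      unfolding I_def K_def using X r by (intro mult_left_mono small_denominators_sum_le) auto
    also have "\<dots> \<le> X ^ D * (r ^ D * Q / (2 * 4 ^ D))"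
    proof (intro mult_left_mono)
      \<comment> \<open>\<open>X ^ D * T\<close> equals \<open>(r / h) ^ D\<close>, so the bad
        points may use \<open>T / 2\<close>. The factor \<open>4 * 16 ^ D\<close> in
        \<open>grid_ratio\<close> makes the main term exactly \<open>T / 4\<close>; the other
        quarter is left for \<open>K\<close>.\<close>
      define T where "T = Q * r ^ D / 4 ^ D"
      have "(16::real) ^ D = 4 ^ D * 4 ^ D" by (simp flip: power_mult_distrib)
      then have "X * (4 * r) ^ D = T / 4"
        by (simp add: X_def \<kappa>_def grid_ratio_def power_mult_distrib T_def)
      moreover have "K \<le> T / 4"
      proof -
        have "K * (4 * 4 ^ D) / r ^ D \<le> Q" using elim(2) Q by simp
        then show ?thesis using r by (simp add: T_def field_simps)
      qed
      moreover have "r ^ D * Q / (2 * 4 ^ D) = T / 2" by (simp add: T_def mult_ac)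
      ultimately show "X * (4 * r) ^ D + K \<le> r ^ D * Q / (2 * 4 ^ D)" by linarith
    qed (use X in simp)
    also have "\<dots> = (r / h) ^ D / 2"
      by (simp add: hX power_mult_distrib power_divide Q_def mult_ac)
    finally have badle: "real (card {z \<in> G. \<not> good z}) \<le> (r / h) ^ D / 2" .
    have "card G = card {z \<in> G. good z} + card {z \<in> G. \<not> good z}"
      using fG by (subst card_Un_disjoint[symmetric]) (auto intro: arg_cong[where f=card])
    then have "(r / h) ^ D / 2 \<le> real (card {z \<in> G. good z})"
      using badle cG by simp
    then show ?case
      using fG Gc unfolding good_def
      by (intro exI[of _ "{z \<in> G. good z}"]) (auto simp: h_def X_def \<kappa>_def Q_def good_def)
  qed
qed

section \<open>Sub-boxes on which some scaled error is close to a given target\<close>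

definition sbox :: "real ^ 'd \<Rightarrow> real \<Rightarrow> (real ^ 'd) set" where
  "sbox c r = {x. \<forall>i. \<bar>x $ i - c $ i\<bar> \<le> r}"

text \<open>The mesh decays exactly like \<open>N powr -(D + 1)\<close>. A sixteenth of it is
  granted twice, to the radius of a sub-box and to the shift of its centre. With the quarter mesh to
  \<open>p / q\<close> this adds up to 3/8 of the mesh, so boxes at distinct grid points stay a
  quarter mesh apart.\<close>

lemma eventually_powr_le_grid_mesh:
  assumes "\<beta> > real D + 1"
  shows "\<forall>\<^sub>F N::nat in sequentially. K * real N powr (-\<beta>) \<le> grid_mesh D N / 16"
proof -
  have "((\<lambda>N::nat. K * real N powr (-(\<beta> - (real D + 1)))) \<longlongrightarrow> K * 0) sequentially"
    using assms by (intro tendsto_intros tendsto_neg_powr filterlim_real_sequentially) auto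
  then have "\<forall>\<^sub>F N::nat in sequentially. K * real N powr (-(\<beta> - (real D + 1))) < 1 / (4 * grid_ratio D)"
    by (rule order_tendstoD) (simp add: grid_ratio_def)
  then show ?thesis
    using eventually_gt_at_top[of 0]
  proof eventually_elim
    case (elim N)
    have e: "real N powr (-\<beta>) = real N powr (-(\<beta> - (real D + 1))) / real N ^ (D + 1)"
    proof -
      have "real N ^ (D + 1) = real N powr (real D + 1)"
        using elim(2) powr_realpow[of "real N" "D + 1"] by (simp add: add.commute)
      then show ?thesis by (simp flip: powr_diff)
    qed
    have "K * real N powr (-\<beta>) = K * real N powr (-(\<beta> - (real D + 1))) / real N ^ (D + 1)"
      unfolding e by simp
    also have "\<dots> \<le> 1 / (4 * grid_ratio D) / real N ^ (D + 1)"
      using elim by (intro divide_right_mono) auto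
    also have "\<dots> = grid_mesh D N / 16"
      by (simp add: grid_mesh_def)
    finally show ?case .
  qed
qed

lemma eventually_grid_mesh_le:
  assumes "r > 0"
  shows "\<forall>\<^sub>F N::nat in sequentially. grid_mesh D N \<le> r"
proof -
  have "\<forall>\<^sub>F N::nat in sequentially. real N \<ge> 4 / (grid_ratio D * r)"
    using filterlim_real_sequentially unfolding filterlim_at_top by blast
  then show ?thesis
    using eventually_gt_at_top[of 0]
  proof eventually_elim
    case (elim N)
    have "4 / (grid_ratio D * r) \<le> real N" by fact
    also have "\<dots> \<le> real N ^ (D + 1)"
      using elim(2) by (intro self_le_power) auto
    finally show ?case
      using assms elim(2) by (simp add: grid_mesh_def field_simps)
  qed
qed

text \<open>Since \<open>q powr \<eta> * (q * \<alpha> - p)\<close> is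
  \<open>q powr (1 + \<eta>)\<close> times \<open>\<alpha> - p / q\<close>, the scaled error is
  exactly \<open>x\<close> at \<open>p / q + x / q powr (1 + \<eta>)\<close>, and deviations from
  that point are magnified by the same factor.\<close>

lemma NA_approx_target:
  fixes x \<alpha> :: "real ^ 'd" and p :: "'d \<Rightarrow> int"
  assumes q: "q > 0" and near: "\<And>i. \<bar>\<alpha> $ i - (real_of_int (p i) / real q + x $ i / real q powr (1 + \<eta>))\<bar> \<le> \<rho>"
    and \<epsilon>: "real q powr (1 + \<eta>) * \<rho> \<le> \<epsilon>"
  shows "\<exists>w\<in>NA \<eta> \<alpha>. \<forall>i. \<bar>w $ i - x $ i\<bar> \<le> \<epsilon>"
proof -
  define w where "w = (\<bar>real_of_int (int q)\<bar> powr \<eta>) *\<^sub>R (real_of_int (int q) *\<^sub>R \<alpha> - (\<chi> i. real_of_int (p i)))"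
  have "w \<in> NA \<eta> \<alpha>"
    unfolding NA_def w_def using q by (intro CollectI exI[of _ "int q"] exI conjI refl) (auto simp: int_vecs_def)
  moreover have "\<bar>w $ i - x $ i\<bar> \<le> \<epsilon>" for i
  proof -
    have e: "real q powr (1 + \<eta>) = real q * real q powr \<eta>"
      using q by (simp add: powr_add)
    have "w $ i - x $ i = real q powr (1 + \<eta>) * (\<alpha> $ i - (real_of_int (p i) / real q + x $ i / real q powr (1 + \<eta>)))"
      using q unfolding w_def e by (simp add: field_simps)
    then have "\<bar>w $ i - x $ i\<bar> = real q powr (1 + \<eta>) * \<bar>\<alpha> $ i - (real_of_int (p i) / real q + x $ i / real q powr (1 + \<eta>))\<bar>"
      by (simp add: abs_mult)
    also have "\<dots> \<le> real q powr (1 + \<eta>) * \<rho>"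
      by (intro mult_left_mono near) auto
    finally show ?thesis using \<epsilon> by linarith
  qed
  ultimately show ?thesis by blast
qed

text \<open>Both bounds on \<open>q\<close> matter: \<open>q \<le> N ^ D\<close> keeps the magnified
  radius \<open>\<rho> N\<close> below \<open>\<epsilon>\<close>, while
  \<open>q \<ge> \<kappa> * N ^ D\<close> keeps the shift towards \<open>x\<close> small. The
  hypothesis on \<open>\<eta>\<close> says that \<open>D * (1 + \<eta>) > D + 1\<close>, so radius
  and shift both decay faster than the mesh.\<close>

lemma eventually_many_target_boxes:
  fixes c x :: "real ^ 'd" and r \<epsilon> \<eta> :: real
  assumes r: "r > 0" and \<epsilon>: "\<epsilon> > 0" and \<eta>: "\<eta> > 1 / real CARD('d)"
  defines "D \<equiv> CARD('d)"
  defines "\<rho> \<equiv> \<lambda>N::nat. \<epsilon> * real N powr (-(real D * (1 + \<eta>)))"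
  shows "\<forall>\<^sub>F N::nat in sequentially. \<rho> N \<le> grid_mesh D N / 16 \<and> grid_mesh D N \<le> r \<and>
    (\<exists>(Z :: ('d \<Rightarrow> int) set) y. finite Z \<and>
      (r / (2 * grid_mesh D N)) ^ D / 2 \<le> real (card Z) \<and>
      (\<forall>z\<in>Z. sbox (y z) (\<rho> N) \<subseteq> sbox c r \<and>
        (\<forall>\<alpha>\<in>sbox (y z) (\<rho> N). (\<forall>i. \<bar>\<alpha> $ i - grid_mesh D N * real_of_int (z i)\<bar> \<le> 3 / 8 * grid_mesh D N) \<and>
           (\<exists>w\<in>NA \<eta> \<alpha>. \<forall>i. \<bar>w $ i - x $ i\<bar> \<le> \<epsilon>))))"
proof -
  define \<kappa> where "\<kappa> = grid_ratio D"
  define \<beta> where "\<beta> = real D * (1 + \<eta>)"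
  have \<eta>0: "\<eta> > 0" using \<eta> by (smt (verit) divide_nonneg_nonneg of_nat_0_le_iff)
  have \<beta>: "\<beta> > real D + 1" "\<beta> > 0"
  proof -
    show "\<beta> > real D + 1" using \<eta> by (simp add: \<beta>_def D_def field_simps)
    then show "\<beta> > 0" by linarith
  qed
  have \<kappa>: "\<kappa> > 0" by (simp add: \<kappa>_def)
  \<comment> \<open>Grid points are taken in the box of half the radius; the sub-boxes reach at most
    3/8 of a mesh \<open>h \<le> r\<close> further and so remain inside
    \<open>sbox c r\<close>.\<close>
  have r2: "r / 2 > 0" using r by simp
  show ?thesis
    using eventually_many_good_grid_points[OF r2, where c="\<lambda>i. c $ i", folded D_def]
      eventually_powr_le_grid_mesh[OF \<beta>(1), of "\<epsilon>"]
      eventually_powr_le_grid_mesh[OF \<beta>(1), of "norm x / \<kappa> powr (1 + \<eta>)"]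
      eventually_grid_mesh_le[OF r, of D] eventually_gt_at_top[of 0]
  proof eventually_elim
    case (elim N)
    define h where "h = grid_mesh D N"
    have h: "h > 0" using elim by (simp add: h_def grid_mesh_pos)
    note el = elim[folded h_def \<kappa>_def]
    obtain Z :: "('d \<Rightarrow> int) set" where Z: "finite Z" "(r / 2 / h) ^ D / 2 \<le> real (card Z)"
      "\<And>z i. z \<in> Z \<Longrightarrow> \<bar>h * real_of_int (z i) - c $ i\<bar> \<le> r / 2"
      "\<And>z. z \<in> Z \<Longrightarrow> \<exists>(q::nat) (p::'d \<Rightarrow> int). \<kappa> * real N ^ D \<le> real q \<and> q \<le> N ^ D \<and>
            (\<forall>i. \<bar>h * real_of_int (z i) - real_of_int (p i) / real q\<bar> \<le> h / 4)"
      using el(1) by blast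
    obtain q p where qp: "\<And>z. z \<in> Z \<Longrightarrow> \<kappa> * real N ^ D \<le> real (q z)" "\<And>z. z \<in> Z \<Longrightarrow> q z \<le> N ^ D"
        "\<And>z i. z \<in> Z \<Longrightarrow> \<bar>h * real_of_int (z i) - real_of_int (p z i) / real (q z)\<bar> \<le> h / 4"
      using Z(4) by metis
    define y :: "('d \<Rightarrow> int) \<Rightarrow> real ^ 'd" where "y z = (\<chi> i. real_of_int (p z i) / real (q z) + x $ i / real (q z) powr (1 + \<eta>))" for z
    have \<rho>: "\<rho> N \<le> h / 16" using el(2) by (simp add: \<rho>_def \<beta>_def)
    have \<rho>0: "\<rho> N \<ge> 0" using \<epsilon> by (simp add: \<rho>_def)
    have box: "sbox (y z) (\<rho> N) \<subseteq> sbox c r \<and>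
        (\<forall>\<alpha>\<in>sbox (y z) (\<rho> N). (\<forall>i. \<bar>\<alpha> $ i - h * real_of_int (z i)\<bar> \<le> 3 / 8 * h) \<and>
           (\<exists>w\<in>NA \<eta> \<alpha>. \<forall>i. \<bar>w $ i - x $ i\<bar> \<le> \<epsilon>))" if z: "z \<in> Z" for z
    proof -
      have Npow: "(real N ^ D) powr (1 + \<eta>) = real N powr \<beta>"
        using el(5) by (simp add: powr_powr \<beta>_def flip: powr_realpow)
      have lb: "\<kappa> powr (1 + \<eta>) * real N powr \<beta> \<le> real (q z) powr (1 + \<eta>)"
      proof -
        have "\<kappa> powr (1 + \<eta>) * real N powr \<beta> = (\<kappa> * real N ^ D) powr (1 + \<eta>)"
          using \<kappa> by (simp add: powr_mult Npow)
        also have "\<dots> \<le> real (q z) powr (1 + \<eta>)"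
          using qp(1)[OF z] \<eta>0 \<kappa> by (intro powr_mono2) auto
        finally show ?thesis .
      qed
      have q0: "q z > 0"
      proof -
        have "0 < \<kappa> * real N ^ D" using \<kappa> el(5) by simp
        then show ?thesis using qp(1)[OF z] by linarith
      qed
      have shift: "\<bar>x $ i / real (q z) powr (1 + \<eta>)\<bar> \<le> h / 16" for i
      proof -
        have pos: "0 < \<kappa> powr (1 + \<eta>) * real N powr \<beta>" using \<kappa> el(5) by simp
        have "\<bar>x $ i / real (q z) powr (1 + \<eta>)\<bar> = \<bar>x $ i\<bar> / real (q z) powr (1 + \<eta>)" by simp
        also have "\<dots> \<le> norm x / (\<kappa> powr (1 + \<eta>) * real N powr \<beta>)"
          using lb pos by (intro frac_le component_le_norm_cart) auto
        also have "\<dots> = norm x / \<kappa> powr (1 + \<eta>) * real N powr - \<beta>"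
          by (simp add: powr_minus_divide)
        finally show ?thesis using el(3) by linarith
      qed
      have close: "\<bar>\<alpha> $ i - h * real_of_int (z i)\<bar> \<le> 3 / 8 * h" if "\<alpha> \<in> sbox (y z) (\<rho> N)" for \<alpha> i
      proof -
        have "\<bar>\<alpha> $ i - (real_of_int (p z i) / real (q z) + x $ i / real (q z) powr (1 + \<eta>))\<bar> \<le> \<rho> N"
          using that by (auto simp: sbox_def y_def)
        then show ?thesis
          using shift[of i] qp(3)[OF z, of i] \<rho> by linarith
      qed
      have "sbox (y z) (\<rho> N) \<subseteq> sbox c r"
      proof
        fix \<alpha> assume a: "\<alpha> \<in> sbox (y z) (\<rho> N)"
        show "\<alpha> \<in> sbox c r"
          unfolding sbox_def
        proof safe
          fix i
          show "\<bar>\<alpha> $ i - c $ i\<bar> \<le> r"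
            using close[OF a, of i] Z(3)[OF z, of i] el(4) h by linarith
        qed
      qed
      moreover have "\<exists>w\<in>NA \<eta> \<alpha>. \<forall>i. \<bar>w $ i - x $ i\<bar> \<le> \<epsilon>" if "\<alpha> \<in> sbox (y z) (\<rho> N)" for \<alpha>
      proof (rule NA_approx_target[OF q0])
        show "\<bar>\<alpha> $ i - (real_of_int (p z i) / real (q z) + x $ i / real (q z) powr (1 + \<eta>))\<bar> \<le> \<rho> N" for i
          using that by (auto simp: sbox_def y_def)
        have "real (q z) \<le> real N ^ D"
          using qp(2)[OF z] by (metis of_nat_le_iff of_nat_power)
        then have "real (q z) powr (1 + \<eta>) \<le> real N powr \<beta>"
          unfolding Npow[symmetric] using \<eta>0 by (intro powr_mono2) auto
        then have "real (q z) powr (1 + \<eta>) * \<rho> N \<le> real N powr \<beta> * \<rho> N"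
          using \<rho>0 by (intro mult_right_mono)
        also have "\<dots> = \<epsilon>"
          using el(5) by (simp add: \<rho>_def powr_minus flip: \<beta>_def)
        finally show "real (q z) powr (1 + \<eta>) * \<rho> N \<le> \<epsilon>" .
      qed
      ultimately show ?thesis using close by blast
    qed
    show ?case
      unfolding h_def[symmetric]
      using Z(1,2) box \<rho> el(4)
      by (intro conjI exI[of _ Z] exI[of _ y]) auto
  qed
qed

text \<open>Fix one box that is hit; the grid index of any other differs from its index by at most
  \<open>u / h + 3 / 4\<close> in each coordinate. For \<open>u < h / 4\<close> this is below 1, so
  the integers agree. Otherwise \<open>u / h \<ge> 1 / 4\<close> absorbs the additive constants of
  the lattice count, which is where 12 comes from.\<close>

lemma card_boxes_hit_le:
  fixes V :: "(real ^ 'd) set" and Z :: "('d \<Rightarrow> int) set"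
  assumes h: "h > 0" and fZ: "finite Z"
    and V: "\<And>x y. x \<in> V \<Longrightarrow> y \<in> V \<Longrightarrow> dist x y \<le> u"
    and B: "\<And>z \<alpha> i. z \<in> Z \<Longrightarrow> \<alpha> \<in> B z \<Longrightarrow> \<bar>\<alpha> $ i - h * real_of_int (z i)\<bar> \<le> 3 / 8 * h"
  shows "real (card {z \<in> Z. V \<inter> B z \<noteq> {}}) \<le> (if u < h / 4 then 1 else (12 * u / h) ^ CARD('d))"
proof (cases "{z \<in> Z. V \<inter> B z \<noteq> {}} = {}")
  case True
  then show ?thesis using h by (simp only: card.empty) auto
next
  case False
  define H where "H = {z \<in> Z. V \<inter> B z \<noteq> {}}"
  obtain z0 where z0: "z0 \<in> H" using False by (auto simp: H_def)
  have fH: "finite H" using fZ by (simp add: H_def)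
  have near: "\<bar>real_of_int (z i) - real_of_int (z0 i)\<bar> \<le> u / h + 3 / 4" if z: "z \<in> H" for z i
  proof -
    obtain a b where ab: "a \<in> V" "a \<in> B z" "b \<in> V" "b \<in> B z0"
      using z z0 by (auto simp: H_def)
    have "\<bar>a $ i - b $ i\<bar> \<le> u"
      using V[OF ab(1,3)] dist_vec_nth_le[of a i b] by (simp add: dist_real_def)
    moreover have "\<bar>a $ i - h * real_of_int (z i)\<bar> \<le> 3 / 8 * h" "\<bar>b $ i - h * real_of_int (z0 i)\<bar> \<le> 3 / 8 * h"
      using B ab z z0 by (auto simp: H_def)
    ultimately have "\<bar>h * real_of_int (z i) - h * real_of_int (z0 i)\<bar> \<le> u + 3 / 4 * h" by linarith
    then have "h * \<bar>real_of_int (z i) - real_of_int (z0 i)\<bar> \<le> u + 3 / 4 * h"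
      using h by (simp add: abs_mult flip: right_diff_distrib)
    then show ?thesis using h by (simp add: field_simps)
  qed
  show ?thesis
  proof (cases "u < h / 4")
    case True
    then have "u / h < 1 / 4" using h by (simp add: field_simps)
    have "H \<subseteq> {z0}"
    proof
      fix z assume z: "z \<in> H"
      have "z i = z0 i" for i
        using near[OF z, of i] \<open>u / h < 1 / 4\<close> by linarith
      then show "z \<in> {z0}" by auto
    qed
    then have "card H \<le> 1" using card_mono[of "{z0}" H] by simp
    then show ?thesis using True unfolding H_def by simp
  next
    case False
    then have u: "u / h \<ge> 1 / 4" using h by (simp add: field_simps)
    have "real (card H) \<le> real (card {z. \<forall>i. \<bar>real_of_int (z i) - real_of_int (z0 i)\<bar> \<le> u / h + 3 / 4})"
      using near by (intro of_nat_mono card_mono finite_lattice_near) auto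
    also have "\<dots> \<le> (2 * (u / h + 3 / 4) + 1) ^ CARD('d)"
      using u by (intro card_lattice_near_le) linarith
    also have "\<dots> \<le> (12 * u / h) ^ CARD('d)"
    proof (rule power_mono)
      have "2 * (v + 3 / 4) + 1 \<le> 12 * v" if "1 / 4 \<le> v" for v :: real
        using that by (simp add: field_simps)
      from this[OF u] show "2 * (u / h + 3 / 4) + 1 \<le> 12 * u / h"
        by simp
      have "0 \<le> u / h" using u by (rule order_trans[rotated]) simp
      then show "0 \<le> 2 * (u / h + 3 / 4) + 1" by simp
    qed
    finally show ?thesis using False unfolding H_def by simp
  qed
qed

lemma mem_sbox_self: "r \<ge> 0 \<Longrightarrow> c \<in> sbox c r"
  by (simp add: sbox_def)

lemma sbox_eq_cbox: "sbox c r = cbox (c - (\<chi> i. r)) (c + (\<chi> i. r))"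
  by (auto simp: sbox_def mem_box_cart abs_le_iff algebra_simps)

text \<open>The critical exponent enters the lower bound here: the left side grows like
  \<open>N\<close> to the power \<open>D * (1 + \<eta>) * s\<close>, the right side like
  \<open>N\<close> to the power \<open>D * (D + 1)\<close>, and the bound on \<open>s\<close> makes
  the first exponent smaller.\<close>

lemma eventually_grid_count_ge:
  assumes r: "r > 0" and \<epsilon>: "\<epsilon> > 0" and \<eta>: "\<eta> > 0" and D: "D > 0" and s: "s < (real D + 1) / (1 + \<eta>)"
  shows "\<forall>\<^sub>F N::nat in sequentially.
    (r / (\<epsilon> * real N powr (-(real D * (1 + \<eta>))))) powr s \<le> (r / (2 * grid_mesh D N)) ^ D / 2"
proof -
  define \<kappa> where "\<kappa> = grid_ratio D"
  define \<beta> where "\<beta> = real D * (1 + \<eta>)"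
  define \<gamma> where "\<gamma> = (real D + 1) * real D - \<beta> * s"
  define K where "K = (r / \<epsilon>) powr s / ((r * \<kappa> / 8) ^ D / 2)"
  have \<kappa>: "\<kappa> > 0" by (simp add: \<kappa>_def)
  have "s * (1 + \<eta>) < real D + 1"
    using s \<eta> by (simp add: field_simps)
  then have "real D * (s * (1 + \<eta>)) < real D * (real D + 1)"
    using D by simp
  then have \<gamma>: "\<gamma> > 0" by (simp add: \<gamma>_def \<beta>_def algebra_simps)
  have "filterlim (\<lambda>N::nat. real N powr \<gamma>) at_top sequentially"
    using filterlim_compose[OF real_powr_at_top[OF \<gamma>] filterlim_real_sequentially] .
  then have "\<forall>\<^sub>F N::nat in sequentially. K \<le> real N powr \<gamma>"
    unfolding filterlim_at_top by blast
  then show ?thesis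
    using eventually_gt_at_top[of 0]
  proof eventually_elim
    case (elim N)
    have N: "real N > 0" using elim by simp
    have "(r / (\<epsilon> * real N powr (-\<beta>))) powr s = (r / \<epsilon> * real N powr \<beta>) powr s"
      by (simp add: powr_minus field_simps)
    also have "\<dots> = (r / \<epsilon>) powr s * real N powr (\<beta> * s)"
      using r \<epsilon> by (subst powr_mult) (simp_all add: powr_powr)
    also have "\<dots> = K * ((r * \<kappa> / 8) ^ D / 2) * real N powr (\<beta> * s)"
      using r \<kappa> by (simp add: K_def)
    also have "\<dots> \<le> real N powr \<gamma> * ((r * \<kappa> / 8) ^ D / 2) * real N powr (\<beta> * s)"
      using elim r \<kappa> by (intro mult_right_mono) auto
    also have "\<dots> = (r * \<kappa> / 8) ^ D / 2 * real N powr ((real D + 1) * real D)"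
      by (simp add: \<gamma>_def flip: powr_add)
    also have "real N powr ((real D + 1) * real D) = (real N ^ (D + 1)) ^ D"
      using powr_realpow[OF N, of "(D + 1) * D"] by (simp add: power_add power_mult[symmetric] algebra_simps)
    also have "(r * \<kappa> / 8) ^ D / 2 * (real N ^ (D + 1)) ^ D = (r / (2 * grid_mesh D N)) ^ D / 2"
      by (simp add: grid_mesh_def \<kappa>_def power_mult_distrib power_divide)
    finally show ?case by (simp add: \<beta>_def)
  qed
qed

text \<open>Chosen for sets larger than the mesh: \<open>12 * u / h\<close> is
  \<open>24 * (u / r) * (r / (2 * h))\<close>, and \<open>(r / (2 * h)) ^ d\<close> is at most twice
  the number of candidate sub-boxes.\<close>

abbreviation hit_const :: "nat \<Rightarrow> real" where
  "hit_const d \<equiv> 2 * 24 ^ d"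

section \<open>Avoiding a small cover\<close>

text \<open>The sizes \<open>u i\<close> only bound distances inside \<open>U i\<close>, so they can
  be positive for every \<open>i\<close>. Boxes shrinking to a point then eventually become smaller
  than each \<open>u i\<close>.\<close>

locale small_cover =
  fixes s :: real and U :: "nat \<Rightarrow> (real ^ 'd) set" and u :: "nat \<Rightarrow> real"
  assumes s_pos: "s > 0" and u_pos: "\<And>i. u i > 0"
    and dist_le: "\<And>i x y. x \<in> U i \<Longrightarrow> y \<in> U i \<Longrightarrow> dist x y \<le> u i"
    and summable_u: "summable (\<lambda>i. u i powr s)"
begin

text \<open>
  A set no smaller than the box it meets contributes 1, so potential below 1 excludes it.
\<close>

definition pot_term :: "real ^ 'd \<Rightarrow> real \<Rightarrow> nat \<Rightarrow> real" where
  "pot_term c r i = (if U i \<inter> sbox c r = {} then 0 else min 1 (hit_const CARD('d) * (u i / r) powr s))"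

definition pot :: "real ^ 'd \<Rightarrow> real \<Rightarrow> real" where
  "pot c r = (\<Sum>i. pot_term c r i)"

lemma hit_const_ge_1: "hit_const CARD('d) \<ge> 1"
  using one_le_power[of "24::real" "CARD('d)"] by linarith

lemma pot_term_nonneg: "pot_term c r i \<ge> 0"
  by (simp add: pot_term_def)

lemma pot_term_le: "r > 0 \<Longrightarrow> pot_term c r i \<le> hit_const CARD('d) / r powr s * u i powr s"
  using u_pos[of i] by (simp add: pot_term_def powr_divide min.coboundedI2)

lemma summable_pot_term: "r > 0 \<Longrightarrow> summable (pot_term c r)"
  using pot_term_le[of r c] pot_term_nonneg[of c r]
  by (intro summable_comparison_test'[where N=0, OF summable_mult[OF summable_u, of "hit_const CARD('d) / r powr s"]])
     simp

lemma pot_term_le_pot: "r > 0 \<Longrightarrow> pot_term c r i \<le> pot c r"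
  unfolding pot_def using sum_le_suminf[OF summable_pot_term, of r "{i}" c] pot_term_nonneg by auto

text \<open>Each term is at most the whole potential, so for a set meeting the box the truncation at
  1 is inactive. If \<open>u i\<close> were at least \<open>r\<close>, the untruncated value would
  already be at least 1.\<close>

lemma pot_lt_1_imp:
  assumes r: "r > 0" and p: "pot c r < 1" and i: "U i \<inter> sbox c r \<noteq> {}"
  shows "u i < r" "pot_term c r i = hit_const CARD('d) * (u i / r) powr s"
proof -
  have *: "min 1 (hit_const CARD('d) * (u i / r) powr s) < 1"
    using pot_term_le_pot[OF r, of c i] p i by (auto simp: pot_term_def)
  then show "pot_term c r i = hit_const CARD('d) * (u i / r) powr s"
    using i by (simp add: pot_term_def)
  show "u i < r"
  proof (rule ccontr)
    assume "\<not> u i < r"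
    then have "(u i / r) powr s \<ge> 1"
      using r s_pos by (intro ge_one_powr_ge_zero) auto
    then have "1 * 1 \<le> hit_const CARD('d) * (u i / r) powr s"
      using hit_const_ge_1 by (intro mult_mono) auto
    then show False using * by simp
  qed
qed

text \<open>First-moment argument: summed over the \<open>M\<close> candidates, the potentials are
  at most \<open>M * pot c r < M\<close>, so some candidate has potential below 1. By linearity this
  reduces to one set \<open>U i\<close> at a time.\<close>

lemma avoiding_subbox:
  fixes x :: "real ^ 'd"
  assumes r: "r > 0" and p: "pot c r < 1" and \<epsilon>: "\<epsilon> > 0"
    and \<eta>: "\<eta> > 1 / real CARD('d)" and s: "s < (real CARD('d) + 1) / (1 + \<eta>)"
  shows "\<exists>c' r'. 0 < r' \<and> r' \<le> r / 2 \<and> pot c' r' < 1 \<and> sbox c' r' \<subseteq> sbox c r \<and>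
           (\<forall>\<alpha>\<in>sbox c' r'. \<exists>w\<in>NA \<eta> \<alpha>. \<forall>i. \<bar>w $ i - x $ i\<bar> \<le> \<epsilon>)"
proof -
  define D where "D = CARD('d)"
  have D0: "D > 0" by (simp add: D_def)
  have \<eta>0: "\<eta> > 0" using \<eta> by (smt (verit) divide_nonneg_nonneg of_nat_0_le_iff)
  \<comment> \<open>Needed for large sets, where the count gives \<open>(u i / r) ^ D\<close> but
    the potential is measured with exponent \<open>s\<close>; the ratio is below 1.\<close>
  have sD: "s \<le> real D"
  proof -
    have "(real D + 1) / (1 + \<eta>) \<le> real D"
      using \<eta> \<eta>0 by (simp add: D_def field_simps)
    then show ?thesis using s by (simp add: D_def)
  qed
  obtain N where N: "N > 0"
    "\<epsilon> * real N powr (-(real D * (1 + \<eta>))) \<le> grid_mesh D N / 16" "grid_mesh D N \<le> r"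
    "\<exists>(Z :: ('d \<Rightarrow> int) set) y. finite Z \<and>
      (r / (2 * grid_mesh D N)) ^ D / 2 \<le> real (card Z) \<and>
      (\<forall>z\<in>Z. sbox (y z) (\<epsilon> * real N powr (-(real D * (1 + \<eta>)))) \<subseteq> sbox c r \<and>
        (\<forall>\<alpha>\<in>sbox (y z) (\<epsilon> * real N powr (-(real D * (1 + \<eta>)))).
           (\<forall>i. \<bar>\<alpha> $ i - grid_mesh D N * real_of_int (z i)\<bar> \<le> 3 / 8 * grid_mesh D N) \<and>
           (\<exists>w\<in>NA \<eta> \<alpha>. \<forall>i. \<bar>w $ i - x $ i\<bar> \<le> \<epsilon>)))"
    "(r / (\<epsilon> * real N powr (-(real D * (1 + \<eta>))))) powr s \<le> (r / (2 * grid_mesh D N)) ^ D / 2"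
    using eventually_happens'[OF sequentially_bot eventually_conj[OF eventually_gt_at_top[of 0]
       eventually_conj[OF eventually_many_target_boxes[OF r \<epsilon> \<eta>, of c x, folded D_def]
         eventually_grid_count_ge[OF r \<epsilon> \<eta>0 D0 s[folded D_def]]]]]
    by - (erule exE, (erule conjE)+, (rule that; assumption))
  define h where "h = grid_mesh D N"
  define \<rho> where "\<rho> = \<epsilon> * real N powr (-(real D * (1 + \<eta>)))"
  have h: "h > 0" using N(1) by (simp add: h_def grid_mesh_pos)
  have \<rho>: "\<rho> > 0" "\<rho> \<le> h / 16" "h \<le> r"
    using \<epsilon> N(1-3) by (auto simp: \<rho>_def h_def)
  obtain Z :: "('d \<Rightarrow> int) set" and y where Z: "finite Z" "(r / (2 * h)) ^ D / 2 \<le> real (card Z)"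
    "\<And>z. z \<in> Z \<Longrightarrow> sbox (y z) \<rho> \<subseteq> sbox c r"
    "\<And>z \<alpha> i. z \<in> Z \<Longrightarrow> \<alpha> \<in> sbox (y z) \<rho> \<Longrightarrow> \<bar>\<alpha> $ i - h * real_of_int (z i)\<bar> \<le> 3 / 8 * h"
    "\<And>z \<alpha>. z \<in> Z \<Longrightarrow> \<alpha> \<in> sbox (y z) \<rho> \<Longrightarrow> \<exists>w\<in>NA \<eta> \<alpha>. \<forall>i. \<bar>w $ i - x $ i\<bar> \<le> \<epsilon>"
    using N(4) unfolding h_def[symmetric] \<rho>_def[symmetric] by blast
  define M where "M = real (card Z)"
  have M1: "(r / \<rho>) powr s \<le> M"
    using N(5) Z(2) unfolding M_def h_def \<rho>_def by linarith
  have M2: "(r / (2 * h)) ^ D \<le> 2 * M"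
    using Z(2) unfolding M_def by linarith
  have M0: "M > 0"
    using M1 r \<rho>(1) by (smt (verit) divide_pos_pos powr_gt_zero)
  have term_sum: "(\<Sum>z\<in>Z. pot_term (y z) \<rho> i) \<le> M * pot_term c r i" for i
  proof (cases "U i \<inter> sbox c r = {}")
    case True
    then have "pot_term (y z) \<rho> i = 0" if "z \<in> Z" for z
      using Z(3)[OF that] by (auto simp: pot_term_def)
    then show ?thesis using True by (simp add: pot_term_def)
  next
    case False
    note ui = pot_lt_1_imp[OF r p False]
    define H where "H = {z \<in> Z. U i \<inter> sbox (y z) \<rho> \<noteq> {}}"
    define m where "m = min 1 (hit_const CARD('d) * (u i / \<rho>) powr s)"
    have m: "0 \<le> m" "m \<le> 1" "m \<le> hit_const CARD('d) * (u i / \<rho>) powr s" by (auto simp: m_def)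
    have "(\<Sum>z\<in>Z. pot_term (y z) \<rho> i) = (\<Sum>z\<in>H. m)"
      unfolding H_def using Z(1)
      by (subst sum.inter_filter) (auto simp: pot_term_def m_def intro!: sum.cong)
    also have "\<dots> = card H * m" by simp
    also have "\<dots> \<le> M * (hit_const CARD('d) * (u i / r) powr s)"
    proof -
      have cH: "real (card H) \<le> (if u i < h / 4 then 1 else (12 * u i / h) ^ D)"
        unfolding H_def D_def by (rule card_boxes_hit_le[OF h Z(1) dist_le]) (use Z(4) in auto)
      show ?thesis
      proof (cases "u i < h / 4")
        \<comment> \<open>A set below the mesh scale meets at most one candidate. It pays the
          untruncated term at scale \<open>\<rho>\<close>, and \<open>M1\<close> trades
          \<open>(r / \<rho>) powr s\<close> for the factor \<open>M\<close>.\<close>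
        case True
        then have "card H * m \<le> 1 * m" using cH m by (intro mult_right_mono) auto
        also have "\<dots> \<le> hit_const CARD('d) * (u i / \<rho>) powr s" using m by simp
        also have "u i / \<rho> = (u i / r) * (r / \<rho>)" using r by simp
        also have "\<dots> powr s = (u i / r) powr s * (r / \<rho>) powr s"
          using r u_pos[of i] \<rho> by (subst powr_mult) auto
        also have "hit_const CARD('d) * \<dots> \<le> hit_const CARD('d) * ((u i / r) powr s * M)"
          using M1 by (intro mult_left_mono) auto
        finally show ?thesis by (simp add: mult_ac)
      next
        \<comment> \<open>A set above the mesh scale may meet many candidates. Each term is bounded
          by 1, and \<open>M2\<close> turns the count into a multiple of \<open>M\<close>.\<close>
        case False
        have "card H * m \<le> (12 * u i / h) ^ D * 1"
          using cH m False u_pos[of i] h by (intro mult_mono) auto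
        also have "12 * u i / h = 24 * (u i / r) * (r / (2 * h))" using r by simp
        also have "\<dots> ^ D * 1 = 24 ^ D * (u i / r) ^ D * (r / (2 * h)) ^ D"
          by (simp only: power_mult_distrib mult_1_right)
        also have "\<dots> \<le> 24 ^ D * (u i / r) ^ D * (2 * M)"
          using M2 u_pos[of i] r by (intro mult_left_mono) auto
        also have "\<dots> \<le> 24 ^ D * (u i / r) powr s * (2 * M)"
        proof (intro mult_right_mono mult_left_mono)
          have "(u i / r) ^ D = (u i / r) powr real D"
            using u_pos[of i] r by (simp add: powr_realpow)
          also have "\<dots> \<le> (u i / r) powr s"
            using u_pos[of i] r ui(1) sD by (intro powr_mono') auto
          finally show "(u i / r) ^ D \<le> (u i / r) powr s" .
        qed (use M0 in auto)
        finally show ?thesis by (simp add: D_def mult_ac)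
      qed
    qed
    finally show ?thesis using ui(2) by simp
  qed
  have "(\<Sum>z\<in>Z. pot (y z) \<rho>) = (\<Sum>i. \<Sum>z\<in>Z. pot_term (y z) \<rho> i)"
    unfolding pot_def by (rule suminf_sum[symmetric]) (rule summable_pot_term[OF \<rho>(1)])
  also have "\<dots> \<le> (\<Sum>i. M * pot_term c r i)"
    by (intro suminf_le term_sum summable_sum summable_mult summable_pot_term r \<rho>(1))
  also have "\<dots> = M * pot c r"
    unfolding pot_def by (rule suminf_mult[OF summable_pot_term[OF r]])
  also have "\<dots> < M * 1" using M0 p by simp
  also have "M * 1 = (\<Sum>z\<in>Z. 1)" by (simp add: M_def)
  finally obtain z where z: "z \<in> Z" "pot (y z) \<rho> < 1"
    by (meson not_le sum_mono)
  have "\<rho> \<le> r / 2" using \<rho> h by linarith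
  then show ?thesis
    using z \<rho>(1) Z(3)[OF z(1)] Z(5)[OF z(1)] by blast
qed

end

section \<open>A point of the set outside the cover\<close>

text \<open>Density already gives accumulation at every point: removing \<open>x\<close> from an
  open neighbourhood leaves an open set, nonempty because singletons are not open.\<close>

lemma mem_D_set_if_dense:
  fixes \<alpha> :: "real ^ 'd"
  assumes "\<And>T. open T \<Longrightarrow> T \<noteq> {} \<Longrightarrow> \<exists>w\<in>NA \<eta> \<alpha>. w \<in> T"
  shows "\<alpha> \<in> D_set \<eta>"
proof -
  have "x islimpt NA \<eta> \<alpha>" for x
    unfolding islimpt_def
  proof safe
    fix T assume T: "x \<in> T" "open T"
    have "T - {x} \<noteq> {}"
      using T not_open_singleton[of x] by (metis Diff_eq_empty_iff subset_singletonD empty_iff)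
    then show "\<exists>y\<in>NA \<eta> \<alpha>. y \<in> T \<and> y \<noteq> x"
      using assms[of "T - {x}"] T by blast
  qed
  then show ?thesis by (simp add: D_set_def acc_NA_def)
qed

context small_cover
begin

lemma D_set_point_outside:
  assumes \<eta>: "\<eta> > 1 / real CARD('d)" and s: "s < (real CARD('d) + 1) / (1 + \<eta>)"
    and small: "hit_const CARD('d) * (\<Sum>i. u i powr s) < 1"
  shows "\<exists>\<alpha>\<in>D_set \<eta>. \<forall>i. \<alpha> \<notin> U i"
proof -
  obtain S :: "(real ^ 'd) set" where S: "countable S" "\<And>X. open X \<Longrightarrow> X \<noteq> {} \<Longrightarrow> \<exists>x\<in>S. x \<in> X"
    using countable_dense_exists by metis
  have S0: "S \<noteq> {}" using S(2)[of UNIV] by auto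
  \<comment> \<open>Step \<open>n\<close> decodes to a pair of a dense target and a tolerance, so
    every target is paired with every tolerance \<open>1 / Suc m\<close>.\<close>
  define tgt where "tgt n = from_nat_into S (fst (prod_decode n))" for n
  define tol where "tol n = 1 / real (Suc (snd (prod_decode n)))" for n
  define near where "near n \<alpha> \<longleftrightarrow> (\<exists>w\<in>NA \<eta> \<alpha>. \<forall>i. \<bar>w $ i - tgt n $ i\<bar> \<le> tol n)" for n and \<alpha> :: "real ^ 'd"
  have pot0: "pot 0 1 < 1"
  proof -
    have "pot 0 1 \<le> (\<Sum>i. hit_const CARD('d) * u i powr s)"
      unfolding pot_def using pot_term_le[of 1 0]
      by (intro suminf_le summable_pot_term summable_mult summable_u) auto
    also have "\<dots> = hit_const CARD('d) * (\<Sum>i. u i powr s)"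
      by (rule suminf_mult[OF summable_u])
    finally show ?thesis using small by linarith
  qed
  have "\<exists>f. \<forall>n. (0 < snd (f n) \<and> snd (f n) \<le> (1/2) ^ n \<and> pot (fst (f n)) (snd (f n)) < 1) \<and>
      (sbox (fst (f (Suc n))) (snd (f (Suc n))) \<subseteq> sbox (fst (f n)) (snd (f n)) \<and>
       (\<forall>\<alpha>\<in>sbox (fst (f (Suc n))) (snd (f (Suc n))). near n \<alpha>))"
  proof (rule dependent_nat_choice)
    show "\<exists>b. 0 < snd b \<and> snd b \<le> (1/2) ^ 0 \<and> pot (fst b) (snd b) < 1"
      using pot0 by (intro exI[of _ "(0, 1)"]) auto
  next
    fix b n assume b: "0 < snd b \<and> snd b \<le> (1/2::real) ^ n \<and> pot (fst b) (snd b) < 1"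
    have "tol n > 0" by (simp add: tol_def)
    with avoiding_subbox[of "snd b" "fst b" "tol n" \<eta> "tgt n"] b \<eta> s
    obtain c' r' where "0 < r'" "r' \<le> snd b / 2" "pot c' r' < 1" "sbox c' r' \<subseteq> sbox (fst b) (snd b)"
        "\<forall>\<alpha>\<in>sbox c' r'. near n \<alpha>"
      unfolding near_def by blast
    moreover have "r' \<le> (1/2) ^ Suc n" using \<open>r' \<le> snd b / 2\<close> b by simp
    ultimately show "\<exists>b'. (0 < snd b' \<and> snd b' \<le> (1/2) ^ Suc n \<and> pot (fst b') (snd b') < 1) \<and>
        sbox (fst b') (snd b') \<subseteq> sbox (fst b) (snd b) \<and> (\<forall>\<alpha>\<in>sbox (fst b') (snd b'). near n \<alpha>)"
      by (intro exI[of _ "(c', r')"]) auto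
  qed
  then obtain f where f: "\<And>n. 0 < snd (f n)" "\<And>n. snd (f n) \<le> (1/2) ^ n" "\<And>n. pot (fst (f n)) (snd (f n)) < 1"
     "\<And>n. sbox (fst (f (Suc n))) (snd (f (Suc n))) \<subseteq> sbox (fst (f n)) (snd (f n))"
     "\<And>n \<alpha>. \<alpha> \<in> sbox (fst (f (Suc n))) (snd (f (Suc n))) \<Longrightarrow> near n \<alpha>"
    by blast
  define F where "F n = sbox (fst (f n)) (snd (f n))" for n
  have "\<Inter>(range F) \<noteq> {}"
  proof (rule compact_nest)
    show "compact (F n)" for n unfolding F_def sbox_eq_cbox by (rule compact_cbox)
    show "F n \<noteq> {}" for n using mem_sbox_self[of "snd (f n)" "fst (f n)"] f(1)[of n] by (force simp: F_def)
    show "F n \<subseteq> F m" if "m \<le> n" for m n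
      using that f(4) lift_Suc_antimono_le[of F m n] by (simp add: F_def)
  qed
  then obtain \<alpha> where \<alpha>: "\<And>n. \<alpha> \<in> F n" by auto
  \<comment> \<open>If \<open>\<alpha>\<close> were in \<open>U i\<close>, every nested box would
    meet \<open>U i\<close>. Potential below 1 then keeps \<open>u i\<close> below all radii, which
    tend to 0.\<close>
  have "\<alpha> \<notin> U i" for i
  proof
    assume i: "\<alpha> \<in> U i"
    obtain n where n: "(1/2::real) ^ n < u i"
      using real_arch_pow_inv[OF u_pos[of i], of "1/2"] by auto
    have "U i \<inter> sbox (fst (f n)) (snd (f n)) \<noteq> {}" using i \<alpha>[of n] by (auto simp: F_def)
    then have "u i < snd (f n)" by (rule pot_lt_1_imp(1)[OF f(1) f(3)])
    then show False using f(2)[of n] n by linarith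
  qed
  moreover have "\<alpha> \<in> D_set \<eta>"
  proof (rule mem_D_set_if_dense)
    fix T :: "(real ^ 'd) set" assume T: "open T" "T \<noteq> {}"
    then obtain x e where xe: "e > 0" "ball x e \<subseteq> T"
      by (meson all_not_in_conv open_contains_ball)
    obtain t where t: "t \<in> S" "t \<in> ball x (e / 2)" using S(2)[of "ball x (e / 2)"] xe by auto
    obtain k where k: "from_nat_into S k = t" using from_nat_into_surj[OF S(1) t(1)] by auto
    \<comment> \<open>Tolerances are per coordinate; bounding the distance by the sum over
      coordinates costs the factor \<open>CARD('d)\<close>.\<close>
    obtain m where m: "real CARD('d) / (e / 2) < real (Suc m)"
      using reals_Archimedean2 by (metis less_Suc_eq less_trans of_nat_less_iff)
    define n where "n = prod_encode (k, m)"
    have tn: "tgt n = t" "tol n = 1 / real (Suc m)" by (auto simp: tgt_def tol_def n_def k)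
    obtain w where w: "w \<in> NA \<eta> \<alpha>" "\<And>i. \<bar>w $ i - t $ i\<bar> \<le> tol n"
      using f(5)[of \<alpha> n] \<alpha>[of "Suc n"] unfolding near_def F_def tn by blast
    have "dist w t \<le> (\<Sum>i\<in>UNIV. \<bar>(w - t) $ i\<bar>)"
      unfolding dist_norm by (rule norm_le_l1_cart)
    also have "\<dots> \<le> (\<Sum>i\<in>(UNIV::'d set). tol n)" using w(2) by (intro sum_mono) simp
    also have "\<dots> = real CARD('d) / real (Suc m)" by (simp add: tn)
    also have "\<dots> < e / 2" using m xe by (simp add: field_simps)
    finally have "w \<in> ball x e"
      using t(2) dist_triangle[of x w t] by (simp add: dist_commute)
    then show "\<exists>w\<in>NA \<eta> \<alpha>. w \<in> T" using w(1) xe(2) by blast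
  qed
  ultimately show ?thesis by blast
qed

end

section \<open>Hausdorff content\<close>

text \<open>Choose for each \<open>A n\<close> a cover within \<open>e / 2 ^ Suc n\<close> of
  optimal and merge the covers through the pairing of naturals; the slacks add up to
  \<open>e\<close>.\<close>

lemma hausdorff_content_UN_le:
  "hausdorff_content s \<delta> (\<Union>n::nat. A n) \<le> (\<Sum>n. hausdorff_content s \<delta> (A n))"
proof (rule ennreal_le_epsilon)
  fix e :: real
  assume fin: "(\<Sum>n. hausdorff_content s \<delta> (A n)) < top" and e: "0 < e"
  have "\<exists>V. A n \<subseteq> (\<Union>i. V i) \<and> (\<forall>i. bounded (V i) \<and> diameter (V i) \<le> \<delta>) \<and>
      (\<Sum>i. ennreal (hd_gauge (V i) s)) < hausdorff_content s \<delta> (A n) + ennreal (e * (1/2) ^ Suc n)" for n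
  proof -
    have ne: "hausdorff_content s \<delta> (A n) \<noteq> \<infinity>"
      using ennreal_suminf_lessD[OF fin, of n] by simp
    from INF_approx_ennreal[OF _ hausdorff_content_def ne, of "e * (1/2) ^ Suc n"] e
    show ?thesis by auto
  qed
  then obtain V where V: "\<And>n. A n \<subseteq> (\<Union>i. V n i)" "\<And>n i. bounded (V n i) \<and> diameter (V n i) \<le> \<delta>"
      "\<And>n. (\<Sum>i. ennreal (hd_gauge (V n i) s)) < hausdorff_content s \<delta> (A n) + ennreal (e * (1/2) ^ Suc n)"
    by metis
  define W where "W k = V (fst (prod_decode k)) (snd (prod_decode k))" for k
  have cov: "(\<Union>n. A n) \<subseteq> (\<Union>k. W k)"
  proof
    fix x assume "x \<in> (\<Union>n. A n)"
    then obtain n i where "x \<in> V n i" using V(1) by blast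
    then have "x \<in> W (prod_encode (n, i))" by (simp add: W_def)
    then show "x \<in> (\<Union>k. W k)" by blast
  qed
  have "hausdorff_content s \<delta> (\<Union>n. A n) \<le> (\<Sum>k. ennreal (hd_gauge (W k) s))"
    unfolding hausdorff_content_def by (intro INF_lower) (use cov V(2) in \<open>auto simp: W_def\<close>)
  also have "\<dots> = (\<Sum>n. \<Sum>i. ennreal (hd_gauge (V n i) s))"
    unfolding W_def
    by (rule suminf_ennreal_2dimen[where f="\<lambda>x. ennreal (hd_gauge (V (fst x) (snd x)) s)"]) simp
  also have "\<dots> \<le> (\<Sum>n. hausdorff_content s \<delta> (A n) + ennreal (e * (1/2) ^ Suc n))"
    using V(3) by (intro suminf_le allI less_imp_le) auto
  also have "\<dots> = (\<Sum>n. hausdorff_content s \<delta> (A n)) + (\<Sum>n. ennreal (e * (1/2) ^ Suc n))"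
    by (intro suminf_add[symmetric]) auto
  also have "(\<Sum>n. ennreal (e * (1/2) ^ Suc n)) = ennreal e"
    using e by (intro suminf_ennreal_eq) (use sums_mult[OF power_half_series, of e] in \<open>auto simp del: power_Suc\<close>)
  finally show "hausdorff_content s \<delta> (\<Union>n. A n) \<le> (\<Sum>n. hausdorff_content s \<delta> (A n)) + ennreal e" .
qed

lemma hausdorff_content_mono:
  "A \<subseteq> B \<Longrightarrow> hausdorff_content s \<delta> A \<le> hausdorff_content s \<delta> B"
  unfolding hausdorff_content_def by (intro INF_superset_mono) auto

text \<open>The finite cover is padded to a sequence by empty sets, which have gauge 0 for every
  exponent.\<close>

lemma hausdorff_content_finite_UN_le:
  assumes J: "finite J" and \<delta>: "\<delta> \<ge> 0"
    and V: "\<And>j. j \<in> J \<Longrightarrow> bounded (V j) \<and> diameter (V j) \<le> \<delta>"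
  shows "hausdorff_content s \<delta> (\<Union>j\<in>J. V j) \<le> (\<Sum>j\<in>J. ennreal (hd_gauge (V j) s))"
proof -
  obtain h where h: "bij_betw h {0..<card J} J"
    using ex_bij_betw_nat_finite[OF J] by blast
  define W where "W i = (if i < card J then V (h i) else {})" for i
  have hJ: "h i \<in> J" if "i < card J" for i
    using h that by (auto simp: bij_betw_def)
  have "J = h ` {0..<card J}" using h by (simp add: bij_betw_def)
  then have "(\<Union>j\<in>J. V j) \<subseteq> (\<Union>i. W i)"
    by (auto simp: W_def) (metis atLeastLessThan_iff imageE)
  moreover have "bounded (W i) \<and> diameter (W i) \<le> \<delta>" for i
    using V[OF hJ] \<delta> by (simp add: W_def)
  ultimately have "hausdorff_content s \<delta> (\<Union>j\<in>J. V j) \<le> (\<Sum>i. ennreal (hd_gauge (W i) s))"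
    unfolding hausdorff_content_def by (intro INF_lower) auto
  also have "\<dots> = (\<Sum>i\<in>{0..<card J}. ennreal (hd_gauge (W i) s))"
    by (rule suminf_finite) (auto simp: W_def hd_gauge_def)
  also have "\<dots> = (\<Sum>i\<in>{0..<card J}. ennreal (hd_gauge (V (h i)) s))"
    by (intro sum.cong) (auto simp: W_def)
  also have "\<dots> = (\<Sum>j\<in>J. ennreal (hd_gauge (V j) s))"
    by (rule sum.reindex_bij_betw[OF h])
  finally show ?thesis .
qed

lemma diameter_sbox_le:
  fixes c :: "real ^ 'd"
  assumes "r \<ge> 0"
  shows "diameter (sbox c r) \<le> 2 * real CARD('d) * r"
proof (rule diameter_le)
  show "sbox c r \<noteq> {} \<or> 0 \<le> 2 * real CARD('d) * r" using assms by simp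
  fix x y assume xy: "x \<in> sbox c r" "y \<in> sbox c r"
  have "\<bar>(x - y) $ i\<bar> \<le> 2 * r" for i
  proof -
    have "\<bar>x $ i - c $ i\<bar> \<le> r" "\<bar>y $ i - c $ i\<bar> \<le> r" using xy by (auto simp: sbox_def)
    then show ?thesis by simp
  qed
  then have "(\<Sum>i\<in>UNIV. \<bar>(x - y) $ i\<bar>) \<le> (\<Sum>i\<in>(UNIV::'d set). 2 * r)"
    by (intro sum_mono) simp
  then show "norm (x - y) \<le> 2 * real CARD('d) * r"
    using norm_le_l1_cart[of "x - y"] by (simp add: mult_ac)
qed

lemma bounded_sbox: "bounded (sbox c r)"
  unfolding sbox_eq_cbox by (rule bounded_cbox)

section \<open>Upper and lower bound\<close>

text \<open>Accumulation at 0 puts infinitely many scaled errors into the unit ball. A fixed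
  \<open>q\<close> accounts for only finitely many, since \<open>q * \<alpha> - p\<close> then has
  coordinates at most 1, so \<open>q\<close> is unbounded in absolute value.\<close>

lemma D_set_approximable:
  fixes \<alpha> :: "real ^ 'd"
  assumes \<alpha>: "\<alpha> \<in> D_set \<eta>" and \<eta>: "\<eta> > 0"
  obtains q :: nat and p :: "'d \<Rightarrow> int" where "q \<ge> Q" "q > 0"
    "\<And>i. \<bar>\<alpha> $ i - real_of_int (p i) / real q\<bar> \<le> real q powr (-(1 + \<eta>))"
proof -
  define f where "f q p = (\<bar>real_of_int q\<bar> powr \<eta>) *\<^sub>R (real_of_int q *\<^sub>R \<alpha> - (\<chi> i. real_of_int (p i)))"
    for q and p :: "'d \<Rightarrow> int"
  have "0 islimpt NA \<eta> \<alpha>" using \<alpha> by (auto simp: D_set_def acc_NA_def)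
  then have inf: "infinite (NA \<eta> \<alpha> \<inter> ball 0 1)" by (simp add: islimpt_eq_infinite_ball)
  have NA: "\<exists>q p. q \<noteq> 0 \<and> w = f q p" if "w \<in> NA \<eta> \<alpha>" for w
  proof -
    obtain q p where qp: "q \<noteq> 0" "p \<in> int_vecs"
        "w = (\<bar>real_of_int q\<bar> powr \<eta>) *\<^sub>R (real_of_int q *\<^sub>R \<alpha> - p)"
      using \<open>w \<in> NA \<eta> \<alpha>\<close> unfolding NA_def by blast
    have "p = (\<chi> i. real_of_int \<lfloor>p $ i\<rfloor>)"
      using qp(2) by (auto simp: int_vecs_def vec_eq_iff elim: Ints_cases)
    then show ?thesis using qp unfolding f_def by (intro exI[of _ q] exI[of _ "\<lambda>i. \<lfloor>p $ i\<rfloor>"]) auto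
  qed
  have fle: "\<bar>real_of_int q * \<alpha> $ i - real_of_int (p i)\<bar> \<le> \<bar>real_of_int q\<bar> powr (-\<eta>)"
    if "f q p \<in> ball 0 1" "q \<noteq> 0" for q p i
  proof -
    have "\<bar>f q p $ i\<bar> \<le> 1"
      using that(1) component_le_norm_cart[of "f q p" i] by (simp add: dist_norm)
    then have "\<bar>real_of_int q\<bar> powr \<eta> * \<bar>real_of_int q * \<alpha> $ i - real_of_int (p i)\<bar> \<le> 1"
      by (simp add: f_def abs_mult)
    then show ?thesis using that(2) by (simp add: powr_minus field_simps)
  qed
  have "\<exists>q p. \<bar>q\<bar> \<ge> int Q \<and> q \<noteq> 0 \<and> f q p \<in> ball 0 1"
  proof (rule ccontr)
    assume no: "\<not> ?thesis"
    have "NA \<eta> \<alpha> \<inter> ball 0 1 \<subseteq> (\<Union>q\<in>{-int Q..int Q}. f q ` {p. \<forall>i. \<bar>real_of_int (p i) - real_of_int q * \<alpha> $ i\<bar> \<le> 1})"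
    proof
      fix w assume w: "w \<in> NA \<eta> \<alpha> \<inter> ball 0 1"
      then obtain q p where qp: "q \<noteq> 0" "w = f q p" using NA by blast
      then have Q: "q \<in> {-int Q..int Q}" using no w by force
      have "\<bar>real_of_int q\<bar> powr (-\<eta>) \<le> \<bar>real_of_int q\<bar> powr 0"
        using qp(1) \<eta> by (intro powr_mono) linarith+
      then have "\<bar>real_of_int (p i) - real_of_int q * \<alpha> $ i\<bar> \<le> 1" for i
        using fle[of q p i] qp w by (simp add: abs_minus_commute)
      then show "w \<in> (\<Union>q\<in>{-int Q..int Q}. f q ` {p. \<forall>i. \<bar>real_of_int (p i) - real_of_int q * \<alpha> $ i\<bar> \<le> 1})"
        using Q qp(2) by blast
    qed
    then have "finite (NA \<eta> \<alpha> \<inter> ball 0 1)"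
      by (rule finite_subset) (intro finite_UN_I finite_imageI finite_lattice_near, simp)
    then show False using inf by simp
  qed
  then obtain q p where qp: "\<bar>q\<bar> \<ge> int Q" "q \<noteq> 0" "f q p \<in> ball 0 1" by blast
  show thesis
  \<comment> \<open>\<open>NA\<close> allows negative denominators; their sign is moved into the
    numerator.\<close>
  proof (rule that[of "nat \<bar>q\<bar>" "\<lambda>i. sgn q * p i"])
    show "Q \<le> nat \<bar>q\<bar>" "0 < nat \<bar>q\<bar>" using qp by auto
    fix i
    have rq: "real (nat \<bar>q\<bar>) = \<bar>real_of_int q\<bar>" by simp
    have "real_of_int (sgn q * p i) / \<bar>real_of_int q\<bar> = real_of_int (p i) / real_of_int q"
      using qp(2) by (cases "q > 0") (auto simp: sgn_if)
    then have "\<bar>\<alpha> $ i - real_of_int (sgn q * p i) / \<bar>real_of_int q\<bar>\<bar>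
        = \<bar>(real_of_int q * \<alpha> $ i - real_of_int (p i)) / real_of_int q\<bar>"
      using qp(2) by (simp add: diff_divide_distrib)
    also have "\<dots> = \<bar>real_of_int q * \<alpha> $ i - real_of_int (p i)\<bar> / \<bar>real_of_int q\<bar>" by simp
    also have "\<dots> \<le> \<bar>real_of_int q\<bar> powr (-\<eta>) / \<bar>real_of_int q\<bar>"
      using fle[OF qp(3,2), of i] by (intro divide_right_mono) auto
    also have "\<dots> = \<bar>real_of_int q\<bar> powr (-(1 + \<eta>))"
    proof -
      have "\<bar>real_of_int q\<bar> powr (-(1 + \<eta>)) = \<bar>real_of_int q\<bar> powr (-\<eta> - 1)" by (rule arg_cong) simp
      also have "\<dots> = \<bar>real_of_int q\<bar> powr (-\<eta>) / \<bar>real_of_int q\<bar>"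
        using qp(2) by (subst powr_diff) simp
      finally show ?thesis by simp
    qed
    finally show "\<bar>\<alpha> $ i - real_of_int (sgn q * p i) / real (nat \<bar>q\<bar>)\<bar> \<le> real (nat \<bar>q\<bar>) powr (-(1 + \<eta>))"
      unfolding rq .
  qed
qed

text \<open>There are at most \<open>((2 * R + 3) * q) ^ d\<close> numerators, each with a box of
  diameter at most \<open>2 * d * q powr -(1 + \<eta>)\<close>. The resulting power of
  \<open>q\<close> is summable exactly when \<open>s\<close> exceeds
  \<open>(d + 1) / (1 + \<eta>)\<close>.\<close>

lemma hausdorff_content_rational_boxes_le:
  fixes \<eta> R s \<delta> :: real
  assumes s: "s > 0" and R: "R \<ge> 0" and q: "q > 0"
    and \<delta>: "2 * real CARD('d) * real q powr (-(1 + \<eta>)) \<le> \<delta>"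
  shows "hausdorff_content s \<delta>
     (\<Union>p\<in>{p::'d::finite \<Rightarrow> int. \<forall>i. \<bar>real_of_int (p i)\<bar> \<le> real q * R + 1}.
        sbox ((\<chi> i. real_of_int (p i) / real q) :: real ^ 'd) (real q powr (-(1 + \<eta>))))
     \<le> ennreal ((2 * R + 3) ^ CARD('d) * (2 * real CARD('d)) powr s * real q powr (real CARD('d) - (1 + \<eta>) * s))"
proof -
  define D where "D = CARD('d)"
  define P where "P = {p::'d \<Rightarrow> int. \<forall>i. \<bar>real_of_int (p i)\<bar> \<le> real q * R + 1}"
  define B where "B p = sbox ((\<chi> i. real_of_int (p i) / real q) :: real ^ 'd) (real q powr (-(1 + \<eta>)))" for p
  define g where "g = (2 * real D * real q powr (-(1 + \<eta>))) powr s"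
  have diam: "diameter (B p) \<le> 2 * real D * real q powr (-(1 + \<eta>))" for p
    unfolding B_def D_def by (rule diameter_sbox_le) simp
  have gauge: "hd_gauge (B p) s \<le> g" for p
    using diam[of p] s diameter_ge_0[OF bounded_sbox, of "(\<chi> i. real_of_int (p i) / real q) :: real ^ 'd" "real q powr (-(1 + \<eta>))"]
    by (auto simp: hd_gauge_def g_def B_def intro!: powr_mono2)
  have fP: "finite P"
    using finite_lattice_near[where 'd='d, of "\<lambda>_. 0"] by (simp add: P_def)
  have "hausdorff_content s \<delta> (\<Union>p\<in>P. B p) \<le> (\<Sum>p\<in>P. ennreal (hd_gauge (B p) s))"
  proof (intro hausdorff_content_finite_UN_le fP conjI)
    show "0 \<le> \<delta>" using \<delta> by (smt (verit) mult_nonneg_nonneg of_nat_0_le_iff powr_ge_zero)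
    show "bounded (B p)" for p by (simp add: B_def bounded_sbox)
    show "diameter (B p) \<le> \<delta>" for p using diam[of p] \<delta> by (simp add: D_def)
  qed
  also have "\<dots> \<le> (\<Sum>p\<in>P. ennreal g)"
    by (intro sum_mono ennreal_leI gauge)
  also have "\<dots> = ennreal (card P * g)"
    by (simp add: ennreal_mult g_def ennreal_of_nat_eq_real_of_nat)
  also have "\<dots> \<le> ennreal ((2 * R + 3) ^ D * (2 * real D) powr s * real q powr (real D - (1 + \<eta>) * s))"
  proof (rule ennreal_leI)
    have q1: "real q \<ge> 1" using q by simp
    have "real (card P) \<le> (2 * (real q * R + 1) + 1) ^ D"
      using card_lattice_near_le[where 'd='d and a="\<lambda>_. 0" and r="real q * R + 1"] R
      by (simp add: P_def D_def)
    also have "\<dots> \<le> ((2 * R + 3) * real q) ^ D"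
      using R q1 by (intro power_mono) (auto simp: algebra_simps)
    also have "\<dots> = (2 * R + 3) ^ D * real q powr real D"
      using q by (simp add: power_mult_distrib powr_realpow)
    finally have "real (card P) * g \<le> (2 * R + 3) ^ D * real q powr real D * g"
      by (intro mult_right_mono) (auto simp: g_def)
    moreover have "g = (2 * real D) powr s * real q powr (- ((1 + \<eta>) * s))"
      unfolding g_def by (subst powr_mult) (simp_all add: powr_powr flip: mult_minus_left)
    moreover have "(2 * R + 3) ^ D * real q powr real D * ((2 * real D) powr s * real q powr (- ((1 + \<eta>) * s)))
       = (2 * R + 3) ^ D * (2 * real D) powr s * (real q powr real D * real q powr (- ((1 + \<eta>) * s)))"
      by (simp add: mult_ac)
    moreover have "real q powr real D * real q powr (- ((1 + \<eta>) * s)) = real q powr (real D - (1 + \<eta>) * s)"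
      by (simp flip: powr_add)
    ultimately show "real (card P) * g \<le> (2 * R + 3) ^ D * (2 * real D) powr s * real q powr (real D - (1 + \<eta>) * s)" by simp
  qed
  finally show ?thesis by (simp add: P_def B_def D_def)
qed

text \<open>Borel-Cantelli argument: any tail of the boxes around rationals covers the points of a
  bounded piece, and tails of a convergent series tend to 0. Boundedness keeps the numerators for
  each \<open>q\<close> finite in number; countable subadditivity removes it.\<close>

lemma hausdorff_measure_D_set_eq_0:
  fixes \<eta> s :: real
  assumes \<eta>: "\<eta> > 0" and s: "s > (real CARD('d) + 1) / (1 + \<eta>)"
  shows "hausdorff_measure s (D_set \<eta> :: (real ^ 'd) set) = 0"
proof -
  define D where "D = CARD('d)"
  have s0: "s > 0" using s \<eta> by (smt (verit) divide_nonneg_nonneg of_nat_0_le_iff)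
  have exps: "real D - (1 + \<eta>) * s < -1"
    using s \<eta> by (simp add: D_def field_simps)
  have piece: "hausdorff_content s \<delta> (D_set \<eta> \<inter> {\<alpha> :: real ^ 'd. \<forall>i. \<bar>\<alpha> $ i\<bar> \<le> R}) = 0"
    if \<delta>: "\<delta> > 0" and R: "R \<ge> 0" for \<delta> R
  proof -
    define E where "E = D_set \<eta> \<inter> {\<alpha> :: real ^ 'd. \<forall>i. \<bar>\<alpha> $ i\<bar> \<le> R}"
    define K where "K = (2 * R + 3) ^ D * (2 * real D) powr s"
    define a where "a q = K * real q powr (real D - (1 + \<eta>) * s)" for q :: nat
    define A where "A q = (\<Union>p\<in>{p::'d \<Rightarrow> int. \<forall>i. \<bar>real_of_int (p i)\<bar> \<le> real q * R + 1}.
        sbox ((\<chi> i. real_of_int (p i) / real q) :: real ^ 'd) (real q powr (-(1 + \<eta>))))" for q :: nat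
    have K0: "K \<ge> 0" using R by (simp add: K_def)
    have suma: "summable a"
      unfolding a_def by (intro summable_mult) (simp add: summable_real_powr_iff exps)
    have "((\<lambda>q::nat. 2 * real D * real q powr (-(1 + \<eta>))) \<longlongrightarrow> 2 * real D * 0) sequentially"
      using \<eta> by (intro tendsto_intros tendsto_neg_powr filterlim_real_sequentially) auto
    then have "\<forall>\<^sub>F q::nat in sequentially. 2 * real D * real q powr (-(1 + \<eta>)) < \<delta>"
      by (rule order_tendstoD) (use \<delta> in simp)
    then obtain Q1 where Q1: "\<And>q. q \<ge> Q1 \<Longrightarrow> 2 * real D * real q powr (-(1 + \<eta>)) < \<delta>"
      unfolding eventually_sequentially by blast
    have "hausdorff_content s \<delta> E \<le> 0 + ennreal e" if e: "e > 0" for e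
    proof -
      obtain Q2 where Q2: "\<And>n. n \<ge> Q2 \<Longrightarrow> norm (\<Sum>i. a (i + n)) < e"
        using suminf_exist_split[OF e suma] by blast
      \<comment> \<open>Beyond \<open>Q1\<close> the boxes are small enough for scale
        \<open>\<delta>\<close>, beyond \<open>Q2\<close> the tail is below \<open>e\<close>, and
        \<open>Suc\<close> excludes the denominator 0.\<close>
      define Q where "Q = Suc (max Q1 Q2)"
      have "E \<subseteq> (\<Union>n. A (n + Q))"
      proof
        fix \<alpha> assume "\<alpha> \<in> E"
        then have \<alpha>: "\<alpha> \<in> D_set \<eta>" "\<And>i. \<bar>\<alpha> $ i\<bar> \<le> R" by (auto simp: E_def)
        obtain q and p :: "'d \<Rightarrow> int" where qp: "q \<ge> Q" "q > 0"
            "\<And>i. \<bar>\<alpha> $ i - real_of_int (p i) / real q\<bar> \<le> real q powr (-(1 + \<eta>))"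
          using D_set_approximable[OF \<alpha>(1) \<eta>] by metis
        have "\<bar>real_of_int (p i)\<bar> \<le> real q * R + 1" for i
        proof -
          have "real q * real q powr (-(1 + \<eta>)) = real q powr (1 + -(1 + \<eta>))"
            using qp(2) by (simp only: powr_add) simp
          also have "\<dots> \<le> real q powr 0"
            using qp(2) \<eta> by (intro powr_mono) auto
          finally have le1: "real q * real q powr (-(1 + \<eta>)) \<le> 1" using qp(2) by simp
          have "\<bar>real_of_int (p i)\<bar> = real q * \<bar>real_of_int (p i) / real q\<bar>"
            using qp(2) by simp
          also have "\<dots> \<le> real q * (R + real q powr (-(1 + \<eta>)))"
            using qp(3)[of i] \<alpha>(2)[of i] by (intro mult_left_mono) linarith+
          also have "\<dots> \<le> real q * R + 1" using le1 by (simp add: algebra_simps)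
          finally show ?thesis .
        qed
        then have "\<alpha> \<in> A q"
          unfolding A_def using qp(3) by (auto simp: sbox_def intro!: exI[of _ p])
        then show "\<alpha> \<in> (\<Union>n. A (n + Q))"
          using qp(1) by (auto intro!: exI[of _ "q - Q"])
      qed
      then have "hausdorff_content s \<delta> E \<le> hausdorff_content s \<delta> (\<Union>n. A (n + Q))"
        by (rule hausdorff_content_mono)
      also have "\<dots> \<le> (\<Sum>n. hausdorff_content s \<delta> (A (n + Q)))"
        by (rule hausdorff_content_UN_le)
      also have "\<dots> \<le> (\<Sum>n. ennreal (a (n + Q)))"
      proof (intro suminf_le allI)
        fix n
        show "hausdorff_content s \<delta> (A (n + Q)) \<le> ennreal (a (n + Q))"
          unfolding A_def a_def K_def D_def
          by (intro hausdorff_content_rational_boxes_le s0 R less_imp_le[OF Q1[unfolded D_def]]) (auto simp: Q_def)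
      qed auto
      also have "\<dots> = ennreal (\<Sum>n. a (n + Q))"
      proof (rule suminf_ennreal2)
        show "0 \<le> a (n + Q)" for n using K0 by (simp add: a_def)
        show "summable (\<lambda>n. a (n + Q))" using suma by simp
      qed
      also have "\<dots> \<le> ennreal e"
      proof (rule ennreal_leI)
        have "Q2 \<le> Q" by (simp add: Q_def)
        from Q2[OF this] show "(\<Sum>n. a (n + Q)) \<le> e" by simp
      qed
      finally show ?thesis by simp
    qed
    then have "hausdorff_content s \<delta> E \<le> 0"
      by (rule ennreal_le_epsilon)
    then show ?thesis by (simp add: E_def)
  qed
  have "hausdorff_content s \<delta> (D_set \<eta> :: (real ^ 'd) set) = 0" if \<delta>: "\<delta> > 0" for \<delta>
  proof -
    have "(D_set \<eta> :: (real ^ 'd) set) \<subseteq> (\<Union>n. D_set \<eta> \<inter> {\<alpha>. \<forall>i. \<bar>\<alpha> $ i\<bar> \<le> real n})"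
    proof
      fix \<alpha> :: "real ^ 'd" assume \<alpha>: "\<alpha> \<in> D_set \<eta>"
      obtain n where "norm \<alpha> \<le> real n" using real_arch_simple by blast
      then have "\<bar>\<alpha> $ i\<bar> \<le> real n" for i using component_le_norm_cart[of \<alpha> i] by linarith
      then show "\<alpha> \<in> (\<Union>n. D_set \<eta> \<inter> {\<alpha>. \<forall>i. \<bar>\<alpha> $ i\<bar> \<le> real n})" using \<alpha> by blast
    qed
    then have "hausdorff_content s \<delta> (D_set \<eta> :: (real ^ 'd) set)
        \<le> hausdorff_content s \<delta> (\<Union>n. D_set \<eta> \<inter> {\<alpha> :: real ^ 'd. \<forall>i. \<bar>\<alpha> $ i\<bar> \<le> real n})"
      by (rule hausdorff_content_mono)
    also have "\<dots> \<le> (\<Sum>n. hausdorff_content s \<delta> (D_set \<eta> \<inter> {\<alpha> :: real ^ 'd. \<forall>i. \<bar>\<alpha> $ i\<bar> \<le> real n}))"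
      by (rule hausdorff_content_UN_le)
    also have "\<dots> = 0" using piece[OF \<delta>] by simp
    finally show ?thesis by simp
  qed
  then show ?thesis by (simp add: hausdorff_measure_def)
qed

section \<open>Lower bound for the dimension\<close>

lemma diameter_powr_le_hd_gauge:
  assumes "bounded V" "diameter V \<le> 1" "0 \<le> t" "t < s"
  shows "diameter V powr s \<le> hd_gauge V t"
proof -
  have "0 \<le> diameter V" using assms(1) by (rule diameter_ge_0)
  then show ?thesis
    using assms by (auto simp: hd_gauge_def intro!: powr_mono' powr_le1)
qed

lemma hausdorff_measure_D_set_neq_0:
  fixes \<eta> t :: real
  assumes \<eta>: "\<eta> > 1 / real CARD('d)" and t: "0 \<le> t" "t < (real CARD('d) + 1) / (1 + \<eta>)"
  shows "hausdorff_measure t (D_set \<eta> :: (real ^ 'd) set) \<noteq> 0"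
proof
  assume null: "hausdorff_measure t (D_set \<eta> :: (real ^ 'd) set) = 0"
  define C where "C = hit_const CARD('d)"
  \<comment> \<open>The cover and the added positive slack each cost at most \<open>e\<close>, so
    the total stays below \<open>3 * e\<close>, which is \<open>1 / C\<close>.\<close>
  define e where "e = 1 / (3 * C)"
  \<comment> \<open>An exponent strictly above \<open>t\<close> is positive even for
    \<open>t = 0\<close>, where the gauge is constant on nonempty sets. For diameters at most 1, the
    power \<open>s\<close> is bounded by the gauge at \<open>t\<close>.\<close>
  obtain s where s: "t < s" "s < (real CARD('d) + 1) / (1 + \<eta>)"
    using dense[OF t(2)] by blast
  have s0: "s > 0" using s t by linarith
  have C0: "C > 0" by (simp add: C_def)
  have e0: "e > 0" using C0 by (simp add: e_def)
  have "hausdorff_content t 1 (D_set \<eta> :: (real ^ 'd) set) \<le> hausdorff_measure t (D_set \<eta> :: (real ^ 'd) set)"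
    unfolding hausdorff_measure_def by (rule SUP_upper) simp
  also have "\<dots> < ennreal e" using null e0 by simp
  finally have "hausdorff_content t 1 (D_set \<eta> :: (real ^ 'd) set) < ennreal e" .
  then obtain V :: "nat \<Rightarrow> (real ^ 'd) set" where V: "D_set \<eta> \<subseteq> (\<Union>i. V i)"
      "\<And>i. bounded (V i)" "\<And>i. diameter (V i) \<le> 1" "(\<Sum>i. ennreal (hd_gauge (V i) t)) < ennreal e"
    unfolding hausdorff_content_def INF_less_iff by auto
  define g where "g i = hd_gauge (V i) t" for i
  have g0: "g i \<ge> 0" for i by (simp add: g_def hd_gauge_def)
  have sumg: "summable g"
    using V(4) g0 by (intro summable_suminf_not_top) (auto simp: g_def)
  have "ennreal (\<Sum>i. g i) < ennreal e"
    using V(4) g0 suminf_ennreal2[OF g0 sumg] by (simp add: g_def)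
  then have ge: "(\<Sum>i. g i) < e"
    using g0 suminf_nonneg[OF sumg] by (simp add: ennreal_less_iff)
  have half: "(\<lambda>i. e * (1/2) ^ Suc i) sums e"
    using sums_mult[OF power_half_series, of e] by simp
  \<comment> \<open>The summand \<open>e / 2 ^ Suc i\<close> keeps \<open>u i\<close> positive when \<open>V i\<close> is a singleton or empty.\<close>
  define v where "v i = g i + e * (1/2) ^ Suc i" for i
  define u where "u i = v i powr (1 / s)" for i
  have v0: "v i > 0" for i
  proof -
    have "0 < e * (1/2) ^ Suc i" using e0 by simp
    then show ?thesis using g0[of i] unfolding v_def by linarith
  qed
  have us: "u i powr s = v i" for i
    using v0[of i] s0 by (simp add: u_def powr_powr)
  have vs: "v sums ((\<Sum>i. g i) + e)"
    unfolding v_def using sumg half by (intro sums_add summable_sums)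
  interpret small_cover s V u
  proof
    show "s > 0" by fact
    show "u i > 0" for i using v0[of i] by (simp add: u_def)
    show "summable (\<lambda>i. u i powr s)" using vs by (simp add: us sums_iff)
    fix i x y assume xy: "x \<in> V i" "y \<in> V i"
    have d0: "0 \<le> diameter (V i)" by (rule diameter_ge_0[OF V(2)])
    have "dist x y \<le> diameter (V i)" by (rule diameter_bounded_bound[OF V(2) xy])
    also have "\<dots> = (diameter (V i) powr s) powr (1 / s)"
      using d0 s0 by (simp add: powr_powr)
    also have "\<dots> \<le> v i powr (1 / s)"
    proof (rule powr_mono2)
      show "diameter (V i) powr s \<le> v i"
        using diameter_powr_le_hd_gauge[OF V(2,3) t(1) s(1), of i] e0
        by (simp add: v_def g_def add_increasing2)
    qed (use s0 in auto)
    finally show "dist x y \<le> u i" by (simp add: u_def)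
  qed
  have "C * (\<Sum>i. u i powr s) = C * ((\<Sum>i. g i) + e)"
    using vs by (simp add: us sums_iff)
  also have "\<dots> < C * (3 * e)"
    using ge e0 C0 by (intro mult_strict_left_mono) auto
  also have "\<dots> = 1" using C0 by (simp add: e_def)
  finally have "\<exists>\<alpha>\<in>D_set \<eta>. \<forall>i. \<alpha> \<notin> V i"
    unfolding C_def by (rule D_set_point_outside[OF \<eta> s(2)])
  then show False using V(1) by blast
qed

theorem theorem3:
  fixes \<eta> :: real
  assumes "\<eta> > 1 / real CARD('d::finite)"
  shows "hausdorff_dim (D_set \<eta> :: (real ^ 'd) set) = (real CARD('d) + 1) / (1 + \<eta>)"
proof -
  define \<sigma> where "\<sigma> = (real CARD('d) + 1) / (1 + \<eta>)"
  define S where "S = {s. s \<ge> 0 \<and> hausdorff_measure s (D_set \<eta> :: (real ^ 'd) set) = 0}"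
  have \<eta>: "\<eta> > 0" using assms by (smt (verit) divide_nonneg_nonneg of_nat_0_le_iff)
  have \<sigma>0: "\<sigma> \<ge> 0" using \<eta> by (simp add: \<sigma>_def)
  have above: "s \<in> S" if "s > \<sigma>" for s
    using that \<sigma>0 hausdorff_measure_D_set_eq_0[where 'd='d, OF \<eta>, of s] by (simp add: S_def \<sigma>_def)
  have below: "\<sigma> \<le> s" if "s \<in> S" for s
    using that hausdorff_measure_D_set_neq_0[where 'd='d, OF assms, of s] by (force simp: S_def \<sigma>_def)
  have "Inf S = \<sigma>"
  proof (rule antisym)
    show "\<sigma> \<le> Inf S" using above[of "\<sigma> + 1"] below by (intro cInf_greatest) auto
    \<comment> \<open>Whether \<open>\<sigma>\<close> itself belongs to \<open>S\<close> is not
      decided, so the bound is obtained from all larger exponents.\<close>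
    show "Inf S \<le> \<sigma>"
    proof (rule dense_ge)
      fix s assume "\<sigma> < s"
      then show "Inf S \<le> s" using above below by (intro cInf_lower bdd_belowI) auto
    qed
  qed
  then show ?thesis by (simp add: hausdorff_dim_def S_def \<sigma>_def)
qed

end
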